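(* Let $n\ge2$ and suppose that $\Omega\in L^s(\mathbf{S}^{n-1})$ with $1<s\leq\infty$, where $\Omega$ is homogeneous of degree zero on $\mathbb R^n$. Let $0<\alpha<n$, $s'\leq p,q<\infty$ and $1/p+1/q=1/r+\alpha/n$ with $0<r<\min\{p,q\}$. (i) If $s'<p,q<\infty$, then there exists a constant $C>0$ such that for any $f\in L^p(\mathbb R^n)$ and $g\in L^q(\mathbb R^n)$ ($C$ independent of $f$ and $g$), $\|f\cdot T_{\Omega,\alpha}(g)\|_{L^{r}}\leq C\|f\|_{L^p}\|g\|_{L^q}$. (ii) If $s'=p$ and $s'<q<\infty$ (or $s'=q$ and $s'<p<\infty$), then there exists a constant $C>0$ such that for any $f\in L^p(\mathbb R^n)$ and $g\in L^q(\mathbb R^n)$ ($C$ independent of $f$ and $g$), $\|f\cdot T_{\Omega,\alpha}(g)\|_{L^{r,\infty}}\leq C\|f\|_{L^p}\|g\|_{L^q}$.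
   Context: $\mathbf{S}^{n-1}$ is the unit sphere of $\mathbb R^n$ with normalized Lebesgue measure; $m$ is Lebesgue measure; $1/s+1/s'=1$ ($s'=1$ if $s=\infty$). $T_{\Omega,\alpha}g(x):=\int_{\mathbb R^n}\frac{\Omega(x-y)}{|x-y|^{n-\alpha}}g(y)\,dy$. For $0<r<\infty$, $\|h\|_{L^r}:=(\int_{\mathbb R^n}|h|^r\,dx)^{1/r}$ and $\|h\|_{L^{r,\infty}}:=\sup_{\lambda>0}\lambda\, m(\{x\in\mathbb R^n:|h(x)|>\lambda\})^{1/r}$ (quasi-norms when $r<1$). *)

theory Defs
  imports "HOL-Analysis.Analysis" "HOL-Probability.Essential_Supremum"
begin

(* Powers of extended nonnegative reals; only meant for exponents a > 0. *)
definition ennreal_powr :: "ennreal \<Rightarrow> real \<Rightarrow> ennreal" where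
  "ennreal_powr x a = (if x = top then top else ennreal (enn2real x powr a))"

(* Only meant for 0 < p; a quasi-norm when p < 1. *)
definition Lp_norm :: "'a measure \<Rightarrow> ennreal \<Rightarrow> ('a \<Rightarrow> 'b::real_normed_vector) \<Rightarrow> ennreal" where
  "Lp_norm M p h =
    (if p = top then esssup M (\<lambda>x. ennreal (norm (h x)))
     else ennreal_powr (\<integral>\<^sup>+x. ennreal (norm (h x) powr enn2real p) \<partial>M) (1 / enn2real p))"

definition Lp_space :: "'a measure \<Rightarrow> ennreal \<Rightarrow> ('a \<Rightarrow> 'b::real_normed_vector) set" where
  "Lp_space M p = {h \<in> borel_measurable M. Lp_norm M p h < top}"

definition weak_Lp_norm :: "'a measure \<Rightarrow> real \<Rightarrow> ('a \<Rightarrow> 'b::real_normed_vector) \<Rightarrow> ennreal" where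
  "weak_Lp_norm M r h =
    (SUP t\<in>{0::real<..}. ennreal t * ennreal_powr (emeasure M {x \<in> space M. norm (h x) > t}) (1 / r))"

(* Normalized Lebesgue measure on the unit sphere, via polar coordinates: the measure of a Borel
   set A of unit vectors is the proportion of the volume of the unit ball that is taken up by the
   cone {x. 0 < |x| < 1 and x/|x| in A}.  The origin is removed because sgn 0 = 0 is not a unit
   vector. *)
definition sphere_measure :: "'a::euclidean_space measure" where
  "sphere_measure = completion
    (scale_measure (1 / emeasure lborel (ball (0::'a) 1))
      (distr (restrict_space lborel (ball 0 1 - {0})) (restrict_space borel (sphere 0 1)) sgn))"

lemma measurable_sgn_sphere:
  "sgn \<in> restrict_space lborel (ball (0::'a::euclidean_space) 1 - {0})
     \<rightarrow>\<^sub>M restrict_space borel (sphere 0 1)"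
proof (rule measurable_restrict_space2)
  show "sgn \<in> space (restrict_space lborel (ball (0::'a) 1 - {0})) \<rightarrow> sphere 0 1"
    by (auto simp: space_restrict_space norm_sgn)
  have "(\<lambda>x::'a. x /\<^sub>R norm x) \<in> borel_measurable lborel"
    by measurable
  then have "sgn \<in> borel_measurable (lborel :: 'a measure)"
    by (simp add: sgn_div_norm[abs_def])
  then show "sgn \<in> borel_measurable (restrict_space lborel (ball (0::'a) 1 - {0}))"
    by (rule measurable_restrict_space1)
qed

lemma emeasure_sphere_measure:
  fixes A :: "'a::euclidean_space set"
  assumes A: "A \<in> sets borel" "A \<subseteq> sphere 0 1"
  shows "emeasure sphere_measure A =
    emeasure lborel {x \<in> ball 0 1 - {0}. sgn x \<in> A} / emeasure lborel (ball (0::'a) 1)"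
proof -
  have A': "A \<in> sets (restrict_space borel (sphere (0::'a) 1))"
    using A by (subst sets_restrict_space_iff) auto
  have cone: "sgn -` A \<inter> space (restrict_space lborel (ball (0::'a) 1 - {0}))
      = {x \<in> ball 0 1 - {0}. sgn x \<in> A}"
    by (auto simp: space_restrict_space)
  let ?D = "distr (restrict_space lborel (ball (0::'a) 1 - {0})) (restrict_space borel (sphere 0 1)) sgn"
  have "emeasure sphere_measure A = 1 / emeasure lborel (ball (0::'a) 1) * emeasure ?D A"
    unfolding sphere_measure_def using A' by (subst emeasure_completion) auto
  also have "emeasure ?D A =
      emeasure (restrict_space lborel (ball (0::'a) 1 - {0})) {x \<in> ball 0 1 - {0}. sgn x \<in> A}"
    using emeasure_distr[OF measurable_sgn_sphere A'] unfolding cone .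
  also have "\<dots> = emeasure lborel {x \<in> ball (0::'a) 1 - {0}. sgn x \<in> A}"
    by (rule emeasure_restrict_space) auto
  finally show ?thesis
    by (simp add: divide_ennreal_def mult.commute)
qed

lemma emeasure_sphere_measure_space:
  "emeasure sphere_measure (sphere (0::'a::euclidean_space) 1) = 1"
proof -
  have cone: "{x \<in> ball 0 1 - {0}. sgn x \<in> sphere (0::'a) 1} = ball 0 1 - {0}"
    by (auto simp: norm_sgn)
  have "emeasure lborel (ball (0::'a) 1 - {0}) = emeasure lborel (ball (0::'a) 1)"
    by (rule emeasure_Diff_null_set) (auto intro: finite_imp_null_set_lborel)
  moreover have "emeasure lborel (ball (0::'a) 1) \<noteq> 0"
    using unit_ball_vol_pos[of "real DIM('a)"] by (simp add: emeasure_ball less_imp_neq[symmetric])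
  moreover have "emeasure lborel (ball (0::'a) 1) \<noteq> top"
    using emeasure_lborel_ball_finite[of "0::'a" 1] by (metis infinity_ennreal_def less_irrefl)
  ultimately show ?thesis
    using emeasure_sphere_measure[of "sphere (0::'a) 1"] cone
    by (simp add: ennreal_divide_self less_top)
qed

definition homogeneous_degree_zero :: "('a::real_vector \<Rightarrow> 'b) \<Rightarrow> bool" where
  "homogeneous_degree_zero \<Omega> \<longleftrightarrow> (\<forall>t>0. \<forall>x. \<Omega> (t *\<^sub>R x) = \<Omega> x)"

definition rough_kernel :: "('a::euclidean_space \<Rightarrow> complex) \<Rightarrow> real \<Rightarrow> 'a \<Rightarrow> complex" where
  "rough_kernel \<Omega> \<alpha> z = \<Omega> z / of_real (norm z powr (real DIM('a) - \<alpha>))"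

definition rough_fractional_integral ::
    "('a::euclidean_space \<Rightarrow> complex) \<Rightarrow> real \<Rightarrow> ('a \<Rightarrow> complex) \<Rightarrow> 'a \<Rightarrow> complex" where
  "rough_fractional_integral \<Omega> \<alpha> g x = (LINT y|lebesgue. rough_kernel \<Omega> \<alpha> (x - y) * g y)"

(* The Bochner integral of a non-integrable function is 0 by convention, so estimates for
   f * rough_fractional_integral say what they should only together with this condition. *)
definition rough_fractional_integral_exists ::
    "('a::euclidean_space \<Rightarrow> complex) \<Rightarrow> real \<Rightarrow> ('a \<Rightarrow> complex) \<Rightarrow> 'a \<Rightarrow> bool" where
  "rough_fractional_integral_exists \<Omega> \<alpha> g x \<longleftrightarrow>
    integrable lebesgue (\<lambda>y. rough_kernel \<Omega> \<alpha> (x - y) * g y)"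

end

theory Submission
  imports Defs
begin

text \<open>
  Let \<open>K\<close> be the modulus of the kernel, \<open>g\<close> normalized in \<open>L\<^sup>q\<close>, and \<open>\<beta> = n/q - \<alpha>\<close>.
  Cutting \<open>K\<close> at radius \<open>\<delta>\<close>, homogeneity gives an \<open>L\<^sup>1\<close> norm of order \<open>\<delta>\<^sup>\<alpha>\<close> inside and, since
  \<open>\<Omega> \<in> L\<^sup>s \<subseteq> L\<^bsup>q'\<^esup>\<close>, an \<open>L\<^bsup>q'\<^esup>\<close> norm of order \<open>\<delta>\<^bsup>-\<beta>\<^esup>\<close> outside. Choosing \<open>\<delta>\<close> from the level
  \<open>\<tau>\<close> and also cutting \<open>g\<close> at a height \<open>h = c \<tau>\<^sup>b\<close>, \<open>b = 1 + \<alpha>/\<beta>\<close>, yields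
  \<open>|{K * |g| > \<tau>}| \<le> h\<^bsup>-1\<^esup> \<integral>\<^bsub>|g| > h\<^esub> |g|\<close>.
  For \<open>q \<ge> 1\<close> this is a weak type bound for \<open>T\<close>, and for \<open>q > 1\<close> integrating it against \<open>\<tau>\<^bsup>bq-1\<^esup>\<close>
  gives the strong type bound with exponent \<open>bq\<close>, where \<open>1/(bq) = 1/q - \<alpha>/n = 1/r - 1/p\<close>.
  Hoelder's inequality with \<open>f\<close> concludes. No interpolation or maximal function is needed, and
  only \<open>q = 1\<close> (which forces \<open>s = \<infinity>\<close>) is restricted to the weak bound.
\<close>

section \<open>Integrals of homogeneous functions\<close>

lemma nn_integral_lborel_affine:
  fixes F :: "'a::euclidean_space \<Rightarrow> ennreal"
  assumes [measurable]: "F \<in> borel_measurable borel" and "c \<noteq> 0"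
  shows "(\<integral>\<^sup>+x. F x \<partial>lborel) = ennreal (\<bar>c\<bar> ^ DIM('a)) * (\<integral>\<^sup>+x. F (t + c *\<^sub>R x) \<partial>lborel)"
proof -
  have "(\<integral>\<^sup>+x. F x \<partial>lborel) = (\<integral>\<^sup>+x. F x \<partial>density (distr lborel borel (\<lambda>x. t + c *\<^sub>R x)) (\<lambda>_. \<bar>c\<bar>^DIM('a)))"
    using lborel_affine[OF \<open>c \<noteq> 0\<close>, of t] by simp
  also have "\<dots> = ennreal (\<bar>c\<bar> ^ DIM('a)) * (\<integral>\<^sup>+x. F (t + c *\<^sub>R x) \<partial>lborel)"
    by (simp add: nn_integral_density nn_integral_distr nn_integral_cmult)
  finally show ?thesis .
qed

lemma nn_integral_lborel_reflect:
  fixes F :: "'a::euclidean_space \<Rightarrow> ennreal"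
  assumes "F \<in> borel_measurable borel"
  shows "(\<integral>\<^sup>+y. F (x - y) \<partial>lborel) = (\<integral>\<^sup>+y. F y \<partial>lborel)"
  using nn_integral_lborel_affine[OF assms, of "-1" x] by simp

text \<open>Reflection preserves null sets. The conclusion is available for every x, not just almost
  every x, which lets the kernel be changed on a null set without creating exceptional points
  x.\<close>

lemma AE_lborel_reflect:
  assumes "AE z in lborel. P (z :: 'a::euclidean_space)"
  shows "AE y in lborel. P (x - y)"
proof -
  obtain N where N: "{z. \<not> P z} \<subseteq> N" "N \<in> null_sets lborel"
    using assms unfolding eventually_ae_filter by auto
  then have [measurable]: "N \<in> sets borel" by auto
  have "(\<integral>\<^sup>+y. indicator N (x - y) \<partial>lborel) = (\<integral>\<^sup>+z. indicator N z \<partial>lborel)"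
    by (rule nn_integral_lborel_reflect) measurable
  also have "\<dots> = 0" using N(2) by (simp add: null_setsD1)
  finally have "AE y in lborel. indicator N (x - y) = (0::ennreal)"
    by (subst (asm) nn_integral_0_iff_AE) auto
  then show ?thesis
    by eventually_elim (use N(1) in \<open>auto simp: indicator_def split: if_splits\<close>)
qed

section \<open>Layer cake integrals in place of polar coordinates\<close>

lemma nn_integral_powr_from_0:
  assumes "a > -1" "c \<ge> 0"
  shows "(\<integral>\<^sup>+t. ennreal (t powr a) * indicator {0..c} t \<partial>lborel) = ennreal (c powr (a + 1) / (a + 1))"
  by (rule nn_integral_has_integral_lebesgue'[OF _ has_integral_powr_from_0[OF assms]]) auto

lemma nn_integral_powr_to_inf:
  assumes "e < -1" "c > 0"
  shows "(\<integral>\<^sup>+t. ennreal (t powr e) * indicator {c..} t \<partial>lborel) = ennreal (- (c powr (e + 1)) / (e + 1))"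
  by (rule nn_integral_has_integral_lebesgue'[OF _ has_integral_powr_to_inf[OF assms]]) auto

text \<open>Substituting \<open>t *\<^sub>R z\<close> for z turns the ball of radius t into the unit
  ball, leaves v unchanged and contributes the Jacobian. The radial estimates below use homogeneity
  only through this scaling law.\<close>

lemma nn_integral_homogeneous_ball:
  fixes v :: "'a::euclidean_space \<Rightarrow> ennreal"
  assumes [measurable]: "v \<in> borel_measurable borel"
    and hom: "homogeneous_degree_zero v" and "t > 0"
  shows "(\<integral>\<^sup>+z. v z * indicator (ball 0 t) z \<partial>lborel)
    = ennreal (t ^ DIM('a)) * (\<integral>\<^sup>+z. v z * indicator (ball 0 1) z \<partial>lborel)"
proof -
  have "indicator (ball 0 t) (t *\<^sub>R z) = (indicator (ball 0 1) z :: ennreal)" for z :: 'a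
    using \<open>t > 0\<close> by (simp add: indicator_def)
  moreover have "v (t *\<^sub>R z) = v z" for z
    using hom \<open>t > 0\<close> by (simp add: homogeneous_degree_zero_def)
  ultimately show ?thesis
    using nn_integral_lborel_affine[OF borel_measurable_times_ennreal[OF assms(1) borel_measurable_indicator[of "ball 0 t"]], of t 0]
      \<open>t > 0\<close> by simp
qed

text \<open>An equality for x > 0. At x = 0 the left side is 0 by the convention for
  \<open>0 powr _\<close> while the integral diverges, hence only an inequality.\<close>

lemma powr_layer_cake:
  assumes "a > 0" "x \<ge> 0"
  shows "ennreal (x powr - a) \<le> (\<integral>\<^sup>+t. ennreal (a * t powr (- a - 1)) * indicator {x<..} t \<partial>lborel)"
proof (cases "x = 0")
  case False
  then have "x > 0" using assms by simp
  have "(\<integral>\<^sup>+t. ennreal (a * t powr (- a - 1)) * indicator {x<..} t \<partial>lborel)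
     = (\<integral>\<^sup>+t. ennreal a * (ennreal (t powr (- a - 1)) * indicator {x..} t) \<partial>lborel)"
    by (rule nn_integral_cong_AE, rule AE_mp[OF AE_lborel_singleton[of x]])
       (auto simp: indicator_def ennreal_mult' \<open>a > 0\<close> less_imp_le)
  also have "\<dots> = ennreal a * ennreal (- (x powr - a) / (- a))"
    using nn_integral_powr_to_inf[of "- a - 1" x] \<open>a > 0\<close> \<open>x > 0\<close> by (simp add: nn_integral_cmult)
  also have "\<dots> = ennreal (x powr - a)"
    using \<open>a > 0\<close> by (simp add: ennreal_mult'[symmetric])
  finally show ?thesis by simp
qed simp

text \<open>Writing the weight as a superposition of indicators of balls and exchanging the
  integrals reduces a radial weight to integrals of v over balls, which scale explicitly when v is
  homogeneous.\<close>

lemma nn_integral_radial_layer_cake: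
  fixes v :: "'a::euclidean_space \<Rightarrow> ennreal" and a :: real
  assumes [measurable]: "v \<in> borel_measurable borel" and "a > 0"
  shows "(\<integral>\<^sup>+z. v z * ennreal (norm z powr - a) \<partial>lborel)
    \<le> (\<integral>\<^sup>+t. ennreal (a * t powr (- a - 1)) * indicator {0<..} t
          * (\<integral>\<^sup>+z. v z * indicator (ball 0 t) z \<partial>lborel) \<partial>lborel)"
proof -
  let ?H = "\<lambda>t z. ennreal (a * t powr (- a - 1)) * indicator {0<..} t * (v z * indicator (ball 0 t) z)"
  have H: "?H t z = v z * (ennreal (a * t powr (- a - 1)) * indicator {norm z<..} t)" for t z
    by (auto simp: indicator_def mult_ac) (meson norm_ge_zero order_le_less_trans)+
  \<comment> \<open>The set \<open>{norm z<..}\<close> varies with z, so joint measurability is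
    derived from the condition \<open>norm z < t\<close> instead.\<close>
  have meas: "(\<lambda>(t, z). v z * (ennreal (a * t powr (- a - 1)) * (if norm z < t then 1 else 0)))
      \<in> borel_measurable (lborel \<Otimes>\<^sub>M lborel)"
    by measurable
  have meas': "(\<lambda>(t, z). ?H t z) \<in> borel_measurable (lborel \<Otimes>\<^sub>M lborel)"
    using meas unfolding H by (simp add: indicator_def)
  have "(\<integral>\<^sup>+z. v z * ennreal (norm z powr - a) \<partial>lborel)
    \<le> (\<integral>\<^sup>+z. v z * (\<integral>\<^sup>+t. ennreal (a * t powr (- a - 1)) * indicator {norm z<..} t \<partial>lborel) \<partial>lborel)"
    using powr_layer_cake[OF \<open>a > 0\<close>] by (intro nn_integral_mono mult_left_mono) auto
  also have "\<dots> = (\<integral>\<^sup>+z. (\<integral>\<^sup>+t. ?H t z \<partial>lborel) \<partial>lborel)"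
    unfolding H by (subst nn_integral_cmult) auto
  also have "\<dots> = (\<integral>\<^sup>+t. (\<integral>\<^sup>+z. ?H t z \<partial>lborel) \<partial>lborel)"
    by (rule lborel_pair.Fubini'[OF meas'])
  also have "\<dots> = (\<integral>\<^sup>+t. ennreal (a * t powr (- a - 1)) * indicator {0<..} t
          * (\<integral>\<^sup>+z. v z * indicator (ball 0 t) z \<partial>lborel) \<partial>lborel)"
    by (intro nn_integral_cong nn_integral_cmult
          borel_measurable_times_ennreal borel_measurable_indicator) auto
  finally show ?thesis .
qed

text \<open>With v cut off to the ball of radius \<delta>, the ball integrals become J min(t,
  \<delta>)^n. Levels t up to \<delta> give a/(n-a) \<delta>^(n-a), where convergence at 0 needs a <
  n; the levels beyond give \<delta>^(n-a), where convergence at infinity needs a > 0. The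
  coefficients add up to n/(n-a).\<close>

lemma nn_integral_homogeneous_near:
  fixes v :: "'a::euclidean_space \<Rightarrow> ennreal" and a :: real
  assumes [measurable]: "v \<in> borel_measurable borel"
    and hom: "homogeneous_degree_zero v"
    and a: "0 < a" "a < DIM('a)" and "\<delta> > 0"
  shows "(\<integral>\<^sup>+z. v z * ennreal (norm z powr - a) * indicator (ball 0 \<delta>) z \<partial>lborel)
    \<le> (\<integral>\<^sup>+z. v z * indicator (ball 0 1) z \<partial>lborel)
       * ennreal (DIM('a) / (DIM('a) - a) * \<delta> powr (DIM('a) - a))"
proof -
  define J where "J = (\<integral>\<^sup>+z. v z * indicator (ball 0 1) z \<partial>lborel)"
  let ?n = "real DIM('a)"
  have inner: "(\<integral>\<^sup>+z. (v z * indicator (ball 0 \<delta>) z) * indicator (ball 0 t) z \<partial>lborel)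
       = J * ennreal (min t \<delta> powr ?n)" if "t > 0" for t
  proof -
    have "(\<integral>\<^sup>+z. (v z * indicator (ball 0 \<delta>) z) * indicator (ball 0 t) z \<partial>lborel)
        = (\<integral>\<^sup>+z. v z * indicator (ball 0 (min t \<delta>)) z \<partial>lborel)"
      by (intro nn_integral_cong) (auto simp: indicator_def)
    then show ?thesis
      using nn_integral_homogeneous_ball[OF _ hom, of "min t \<delta>"] that \<open>\<delta> > 0\<close>
      by (simp add: J_def powr_realpow mult.commute)
  qed
  have pt: "ennreal (a * t powr (- a - 1)) * indicator {0<..} t * (J * ennreal (min t \<delta> powr ?n))
     \<le> J * ennreal a * (ennreal (t powr (?n - a - 1)) * indicator {0..\<delta>} t)
       + J * ennreal (a * \<delta> powr ?n) * (ennreal (t powr (- a - 1)) * indicator {\<delta>..} t)" for t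
  proof -
    consider "t \<le> 0" | "0 < t" "t \<le> \<delta>" | "\<delta> < t" by linarith
    then show ?thesis
    proof cases
      case 2
      have "t powr (- a - 1) * t powr ?n = t powr (?n - a - 1)"
        by (simp add: powr_add[symmetric] algebra_simps)
      then have "ennreal (a * t powr (- a - 1)) * ennreal (t powr ?n) = ennreal a * ennreal (t powr (?n - a - 1))"
        using a by (simp add: ennreal_mult'[symmetric] mult.assoc)
      then have "ennreal (a * t powr (- a - 1)) * (J * ennreal (t powr ?n)) = J * ennreal a * ennreal (t powr (?n - a - 1))"
        by (simp add: mult_ac)
      then show ?thesis using 2 by (auto simp: min_def)
    next
      case 3
      have "ennreal (a * t powr (- a - 1)) * ennreal (\<delta> powr ?n) = ennreal (a * \<delta> powr ?n) * ennreal (t powr (- a - 1))"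
        using a by (simp add: ennreal_mult'[symmetric] mult_ac)
      then have "ennreal (a * t powr (- a - 1)) * (J * ennreal (\<delta> powr ?n)) = J * ennreal (a * \<delta> powr ?n) * ennreal (t powr (- a - 1))"
        by (simp add: mult_ac)
      then show ?thesis using 3 \<open>\<delta> > 0\<close> by (auto simp: min_def)
    qed auto
  qed
  have "(\<integral>\<^sup>+z. v z * ennreal (norm z powr - a) * indicator (ball 0 \<delta>) z \<partial>lborel)
     = (\<integral>\<^sup>+z. (v z * indicator (ball 0 \<delta>) z) * ennreal (norm z powr - a) \<partial>lborel)"
    by (simp add: mult_ac)
  also have "\<dots> \<le> (\<integral>\<^sup>+t. ennreal (a * t powr (- a - 1)) * indicator {0<..} t
          * (\<integral>\<^sup>+z. (v z * indicator (ball 0 \<delta>) z) * indicator (ball 0 t) z \<partial>lborel) \<partial>lborel)"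
    by (intro nn_integral_radial_layer_cake borel_measurable_times_ennreal borel_measurable_indicator)
       (use a in auto)
  also have "\<dots> \<le> (\<integral>\<^sup>+t. J * ennreal a * (ennreal (t powr (?n - a - 1)) * indicator {0..\<delta>} t)
       + J * ennreal (a * \<delta> powr ?n) * (ennreal (t powr (- a - 1)) * indicator {\<delta>..} t) \<partial>lborel)"
  proof (rule nn_integral_mono)
    fix t
    show "ennreal (a * t powr (- a - 1)) * indicator {0<..} t
          * (\<integral>\<^sup>+z. (v z * indicator (ball 0 \<delta>) z) * indicator (ball 0 t) z \<partial>lborel)
      \<le> J * ennreal a * (ennreal (t powr (?n - a - 1)) * indicator {0..\<delta>} t)
       + J * ennreal (a * \<delta> powr ?n) * (ennreal (t powr (- a - 1)) * indicator {\<delta>..} t)"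
      using pt[of t] inner[of t] by (cases "t > 0") auto
  qed
  also have "\<dots> = J * ennreal a * ennreal (\<delta> powr (?n - a) / (?n - a))
       + J * ennreal (a * \<delta> powr ?n) * ennreal (\<delta> powr (- a) / a)"
    using nn_integral_powr_from_0[of "?n - a - 1" \<delta>] nn_integral_powr_to_inf[of "- a - 1" \<delta>] a \<open>\<delta> > 0\<close>
    by (simp add: nn_integral_add nn_integral_cmult)
  also have "\<dots> = J * (ennreal (a * (\<delta> powr (?n - a) / (?n - a))) + ennreal (\<delta> powr (?n - a)))"
  proof -
    have "(a * \<delta> powr ?n) * (\<delta> powr (- a) / a) = \<delta> powr (?n - a)"
      using a by (simp add: powr_diff powr_minus divide_simps)
    then have "ennreal (a * \<delta> powr ?n) * ennreal (\<delta> powr (- a) / a) = ennreal (\<delta> powr (?n - a))"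
      using a by (simp add: ennreal_mult'[symmetric])
    then show ?thesis
      using a by (simp add: distrib_left mult.assoc ennreal_mult'[symmetric])
  qed
  also have "\<dots> = J * ennreal (?n / (?n - a) * \<delta> powr (?n - a))"
  proof -
    have "a * (\<delta> powr (?n - a) / (?n - a)) + \<delta> powr (?n - a) = ?n / (?n - a) * \<delta> powr (?n - a)"
      using a by (simp add: field_simps)
    then show ?thesis using a by (subst ennreal_plus[symmetric]) auto
  qed
  finally show ?thesis by (simp add: J_def)
qed

text \<open>Balls of radius t < \<delta> miss the support of the cut-off function, and larger ones
  are estimated by the full ball, which only worsens the constant from n/(a-n) to a/(a-n). What
  remains is the integral of t^(n-a-1) from \<delta> to infinity, convergent because a > n.\<close>

lemma nn_integral_homogeneous_far:
  fixes v :: "'a::euclidean_space \<Rightarrow> ennreal" and a :: real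
  assumes [measurable]: "v \<in> borel_measurable borel"
    and hom: "homogeneous_degree_zero v"
    and a: "a > DIM('a)" and "\<delta> > 0"
  shows "(\<integral>\<^sup>+z. v z * ennreal (norm z powr - a) * indicator (- ball 0 \<delta>) z \<partial>lborel)
    \<le> (\<integral>\<^sup>+z. v z * indicator (ball 0 1) z \<partial>lborel)
       * ennreal (a / (a - DIM('a)) * \<delta> powr (DIM('a) - a))"
proof -
  define J where "J = (\<integral>\<^sup>+z. v z * indicator (ball 0 1) z \<partial>lborel)"
  let ?n = "real DIM('a)"
  have "a > 0" using a by (rule less_trans[rotated]) simp
  have pt: "ennreal (a * t powr (- a - 1)) * indicator {0<..} t
          * (\<integral>\<^sup>+z. (v z * indicator (- ball 0 \<delta>) z) * indicator (ball 0 t) z \<partial>lborel)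
     \<le> J * ennreal a * (ennreal (t powr (?n - a - 1)) * indicator {\<delta>..} t)" for t
  proof (cases "t \<ge> \<delta>")
    case True
    have "(\<integral>\<^sup>+z. (v z * indicator (- ball 0 \<delta>) z) * indicator (ball 0 t) z \<partial>lborel)
        \<le> (\<integral>\<^sup>+z. v z * indicator (ball 0 t) z \<partial>lborel)"
      by (intro nn_integral_mono) (auto simp: indicator_def)
    also have "\<dots> = J * ennreal (t powr ?n)"
      using nn_integral_homogeneous_ball[OF _ hom, of t] True \<open>\<delta> > 0\<close>
      by (simp add: J_def powr_realpow mult.commute)
    finally have "ennreal (a * t powr (- a - 1))
          * (\<integral>\<^sup>+z. (v z * indicator (- ball 0 \<delta>) z) * indicator (ball 0 t) z \<partial>lborel)
       \<le> ennreal (a * t powr (- a - 1)) * (J * ennreal (t powr ?n))"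
      by (rule mult_left_mono) simp
    also have "\<dots> = J * ennreal a * ennreal (t powr (?n - a - 1))"
    proof -
      have "t powr (- a - 1) * t powr ?n = t powr (?n - a - 1)"
        by (simp add: powr_add[symmetric] algebra_simps)
      then have "ennreal (a * t powr (- a - 1)) * ennreal (t powr ?n) = ennreal a * ennreal (t powr (?n - a - 1))"
        using \<open>a > 0\<close> by (simp add: ennreal_mult'[symmetric] mult.assoc)
      then show ?thesis by (simp add: mult_ac)
    qed
    finally show ?thesis using True \<open>\<delta> > 0\<close> by simp
  next
    case False
    then have "(\<lambda>z. (v z * indicator (- ball 0 \<delta>) z) * indicator (ball 0 t) z) = (\<lambda>_. 0)"
      by (auto simp: indicator_def fun_eq_iff)
    then show ?thesis by (simp only:) simp
  qed
  have "(\<integral>\<^sup>+z. v z * ennreal (norm z powr - a) * indicator (- ball 0 \<delta>) z \<partial>lborel)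
     = (\<integral>\<^sup>+z. (v z * indicator (- ball 0 \<delta>) z) * ennreal (norm z powr - a) \<partial>lborel)"
    by (simp add: mult_ac)
  also have "\<dots> \<le> (\<integral>\<^sup>+t. ennreal (a * t powr (- a - 1)) * indicator {0<..} t
          * (\<integral>\<^sup>+z. (v z * indicator (- ball 0 \<delta>) z) * indicator (ball 0 t) z \<partial>lborel) \<partial>lborel)"
    by (intro nn_integral_radial_layer_cake borel_measurable_times_ennreal borel_measurable_indicator)
       (use \<open>a > 0\<close> in auto)
  also have "\<dots> \<le> (\<integral>\<^sup>+t. J * ennreal a * (ennreal (t powr (?n - a - 1)) * indicator {\<delta>..} t) \<partial>lborel)"
    by (rule nn_integral_mono) (rule pt)
  also have "\<dots> = J * ennreal a * ennreal (- (\<delta> powr (?n - a)) / (?n - a))"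
    using nn_integral_powr_to_inf[of "?n - a - 1" \<delta>] a \<open>\<delta> > 0\<close> by (simp add: nn_integral_cmult)
  also have "\<dots> = J * ennreal (a / (a - ?n) * \<delta> powr (?n - a))"
  proof -
    have "- (\<delta> powr (?n - a)) / (?n - a) = \<delta> powr (?n - a) / (a - ?n)"
      by (metis minus_diff_eq minus_divide_left minus_divide_right)
    then show ?thesis
      using \<open>a > 0\<close> by (simp add: mult.assoc ennreal_mult'[symmetric])
  qed
  finally show ?thesis by (simp add: J_def)
qed

section \<open>Distribution of truncated convolutions\<close>

text \<open>The two cut-offs are tuned together so that the far kernel, and the near kernel acting
  on values of G up to h, each contribute at most \<tau>/3. A total above \<tau> then forces the
  near kernel acting on the values above h to reach \<tau>/3, and Markov's inequality with the L^1
  norm of that piece bounds the measure. Keeping the integral over \<open>ennreal h < G y\<close>,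
  rather than estimating it at once, is what later permits a strong type bound.\<close>

lemma truncated_convolution_distribution:
  fixes k G :: "'a::euclidean_space \<Rightarrow> ennreal" and A B \<alpha> \<beta> \<tau> h :: real
  assumes [measurable]: "k \<in> borel_measurable borel" "G \<in> borel_measurable borel"
    and pos: "A > 0" "B > 0" "\<beta> > 0" "\<tau> > 0"
    and near: "\<And>\<delta>. \<delta> > 0 \<Longrightarrow> (\<integral>\<^sup>+z. k z * indicator (ball 0 \<delta>) z \<partial>lborel) \<le> ennreal (A * \<delta> powr \<alpha>)"
    and far: "\<And>\<delta> x. \<delta> > 0 \<Longrightarrow>
       (\<integral>\<^sup>+y. k (x - y) * indicator (- ball 0 \<delta>) (x - y) * G y \<partial>lborel) \<le> ennreal (B * \<delta> powr - \<beta>)"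
    and h: "h = (3 * B) powr - (\<alpha> / \<beta>) / (3 * A) * \<tau> powr (1 + \<alpha> / \<beta>)"
  shows "emeasure lborel {x. ennreal \<tau> < (\<integral>\<^sup>+y. k (x - y) * G y \<partial>lborel)}
    \<le> ennreal (1 / h) * (\<integral>\<^sup>+y. G y * indicator {y. ennreal h < G y} y \<partial>lborel)"
proof -
  \<comment> \<open>This is the solution of B \<delta>^-\<beta> = \<tau>/3.\<close>
  define \<delta> where "\<delta> = (\<tau> / (3 * B)) powr (- 1 / \<beta>)"
  have \<delta>: "\<delta> > 0" using pos by (simp add: \<delta>_def)
  have far_level: "B * \<delta> powr - \<beta> = \<tau> / 3"
    using pos by (simp add: \<delta>_def powr_powr)
  have "h > 0" using pos h by simp
  have "\<delta> powr \<alpha> = (\<tau> / (3 * B)) powr - (\<alpha> / \<beta>)"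
    by (simp add: \<delta>_def powr_powr)
  also have "\<dots> = \<tau> powr - (\<alpha> / \<beta>) / (3 * B) powr - (\<alpha> / \<beta>)"
    using pos by (subst powr_divide) auto
  finally have \<delta>_powr: "\<delta> powr \<alpha> = \<tau> powr - (\<alpha> / \<beta>) / (3 * B) powr - (\<alpha> / \<beta>)" .
  \<comment> \<open>The prescribed h is the solution of this equation once \<delta> is
    fixed.\<close>
  have near_level: "h * (A * \<delta> powr \<alpha>) = \<tau> / 3"
  proof -
    have "\<tau> powr (1 + \<alpha> / \<beta>) = \<tau> * \<tau> powr (\<alpha> / \<beta>)"
      using pos by (simp add: powr_add)
    then show ?thesis
      using pos by (simp only: h \<delta>_powr) (simp add: powr_minus divide_simps)
  qed
  \<comment> \<open>The far part and the low part each contribute at most \<open>\<tau> / 3\<close>, so only the near part of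
    the high values of \<open>G\<close> matters.\<close>
  let ?k1 = "\<lambda>z. k z * indicator (ball 0 \<delta>) z"
  let ?k2 = "\<lambda>z. k z * indicator (- ball 0 \<delta>) z"
  let ?H = "\<lambda>y. G y * indicator {y. ennreal h < G y} y"
  have [measurable]: "?k1 \<in> borel_measurable borel" "?k2 \<in> borel_measurable borel"
    by (intro borel_measurable_times_ennreal borel_measurable_indicator; simp)+
  have [measurable]: "?H \<in> borel_measurable borel"
    by measurable
  define V where "V x = (\<integral>\<^sup>+y. ?k1 (x - y) * ?H y \<partial>lborel)" for x
  have [measurable]: "V \<in> borel_measurable borel"
    unfolding V_def by measurable
  have U_le: "(\<integral>\<^sup>+y. k (x - y) * G y \<partial>lborel) \<le> ennreal (\<tau> / 3) + ennreal (\<tau> / 3) + V x" for x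
  proof -
    have "(\<integral>\<^sup>+y. k (x - y) * G y \<partial>lborel)
       \<le> (\<integral>\<^sup>+y. ?k2 (x - y) * G y + ennreal h * ?k1 (x - y) + ?k1 (x - y) * ?H y \<partial>lborel)"
    proof (rule nn_integral_mono)
      fix y
      show "k (x - y) * G y \<le> ?k2 (x - y) * G y + ennreal h * ?k1 (x - y) + ?k1 (x - y) * ?H y"
        by (cases "x - y \<in> ball 0 \<delta>"; cases "ennreal h < G y")
           (auto simp: mult.commute[of "ennreal h"] intro!: mult_left_mono)
    qed
    also have "\<dots> = (\<integral>\<^sup>+y. ?k2 (x - y) * G y \<partial>lborel) + ennreal h * (\<integral>\<^sup>+y. ?k1 (x - y) \<partial>lborel) + V x"
      unfolding V_def by (subst nn_integral_add, measurable)+ (simp add: nn_integral_cmult)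
    also have "(\<integral>\<^sup>+y. ?k1 (x - y) \<partial>lborel) = (\<integral>\<^sup>+y. ?k1 y \<partial>lborel)"
      by (rule nn_integral_lborel_reflect) measurable
    also have "(\<integral>\<^sup>+y. ?k2 (x - y) * G y \<partial>lborel) + ennreal h * (\<integral>\<^sup>+y. ?k1 y \<partial>lborel) + V x
       \<le> ennreal (B * \<delta> powr - \<beta>) + ennreal h * ennreal (A * \<delta> powr \<alpha>) + V x"
      by (intro add_mono mult_left_mono far near \<delta>) auto
    also have "\<dots> = ennreal (\<tau> / 3) + ennreal (\<tau> / 3) + V x"
      using \<open>h > 0\<close> pos by (simp only: far_level near_level[symmetric] ennreal_mult' less_imp_le)
    finally show ?thesis .
  qed
  have V_integral: "(\<integral>\<^sup>+x. V x \<partial>lborel) \<le> ennreal (A * \<delta> powr \<alpha>) * (\<integral>\<^sup>+y. ?H y \<partial>lborel)"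
  proof -
    have "(\<integral>\<^sup>+x. V x \<partial>lborel) = (\<integral>\<^sup>+y. (\<integral>\<^sup>+x. ?k1 (x - y) * ?H y \<partial>lborel) \<partial>lborel)"
      unfolding V_def by (rule lborel_pair.Fubini') measurable
    also have "\<dots> = (\<integral>\<^sup>+y. (\<integral>\<^sup>+x. ?k1 (x - y) \<partial>lborel) * ?H y \<partial>lborel)"
      by (intro nn_integral_cong nn_integral_multc) measurable
    also have "\<dots> = (\<integral>\<^sup>+y. (\<integral>\<^sup>+x. ?k1 x \<partial>lborel) * ?H y \<partial>lborel)"
    proof -
      have "(\<integral>\<^sup>+x. ?k1 (x - y) \<partial>lborel) = (\<integral>\<^sup>+x. ?k1 x \<partial>lborel)" for y
        using nn_integral_lborel_affine[of ?k1 1 "- y"] by simp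
      then show ?thesis by simp
    qed
    also have "\<dots> \<le> (\<integral>\<^sup>+y. ennreal (A * \<delta> powr \<alpha>) * ?H y \<partial>lborel)"
      by (intro nn_integral_mono mult_right_mono near \<delta>) auto
    finally show ?thesis by (simp add: nn_integral_cmult)
  qed
  have "{x. ennreal \<tau> < (\<integral>\<^sup>+y. k (x - y) * G y \<partial>lborel)} \<subseteq> {x \<in> UNIV. 1 \<le> ennreal (3 / \<tau>) * V x}"
  proof clarsimp
    fix x assume x: "ennreal \<tau> < (\<integral>\<^sup>+y. k (x - y) * G y \<partial>lborel)"
    \<comment> \<open>Otherwise the three thirds would add up to at most \<tau>, against the strict
      inequality assumed at x.\<close>
    have "ennreal (\<tau> / 3) \<le> V x"
    proof (rule ccontr)
      assume "\<not> ennreal (\<tau> / 3) \<le> V x"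
      then have "ennreal (\<tau> / 3) + ennreal (\<tau> / 3) + V x \<le> ennreal (\<tau> / 3) + ennreal (\<tau> / 3) + ennreal (\<tau> / 3)"
        by (intro add_mono) auto
      also have "\<dots> = ennreal \<tau>" using pos by (simp add: ennreal_plus[symmetric] del: ennreal_plus)
      finally show False using U_le[of x] x by simp
    qed
    then have "ennreal (3 / \<tau>) * ennreal (\<tau> / 3) \<le> ennreal (3 / \<tau>) * V x"
      by (rule mult_left_mono) simp
    then show "1 \<le> ennreal (3 / \<tau>) * V x"
      using pos by (simp add: ennreal_mult'[symmetric])
  qed
  then have "emeasure lborel {x. ennreal \<tau> < (\<integral>\<^sup>+y. k (x - y) * G y \<partial>lborel)}
     \<le> emeasure lborel {x \<in> UNIV. 1 \<le> ennreal (3 / \<tau>) * V x}"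
    by (rule emeasure_mono) measurable
  also have "\<dots> \<le> ennreal (3 / \<tau>) * (\<integral>\<^sup>+x. V x * indicator UNIV x \<partial>lborel)"
    by (rule nn_integral_Markov_inequality) auto
  also have "\<dots> \<le> ennreal (3 / \<tau>) * (ennreal (A * \<delta> powr \<alpha>) * (\<integral>\<^sup>+y. ?H y \<partial>lborel))"
    using V_integral by (intro mult_left_mono) auto
  also have "\<dots> = ennreal (1 / h) * (\<integral>\<^sup>+y. ?H y \<partial>lborel)"
  proof -
    have "3 / \<tau> * (A * \<delta> powr \<alpha>) = 1 / h"
      using near_level pos \<open>h > 0\<close> by (simp add: field_simps)
    then show ?thesis
      using pos by (simp add: mult.assoc[symmetric] ennreal_mult'[symmetric])
  qed
  finally show ?thesis .
qed

section \<open>From the distribution inequality to weak and strong bounds\<close>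

text \<open>Where \<gamma> > h, the factor \<gamma>^(1-q) is at most h^(1-q) because 1 - q is not
  positive. This turns the distribution inequality into a weak type bound, the case q = 1
  included.\<close>

lemma nn_integral_above_level_le:
  fixes \<gamma> :: "'a \<Rightarrow> real"
  assumes [measurable]: "\<gamma> \<in> borel_measurable M" and "\<And>y. \<gamma> y \<ge> 0" "q \<ge> 1" "h > 0"
  shows "ennreal (1 / h) * (\<integral>\<^sup>+y. ennreal (\<gamma> y) * indicator {y. ennreal h < ennreal (\<gamma> y)} y \<partial>M)
    \<le> ennreal (h powr - q) * (\<integral>\<^sup>+y. ennreal (\<gamma> y powr q) \<partial>M)"
proof -
  have "ennreal (\<gamma> y) * indicator {y. ennreal h < ennreal (\<gamma> y)} y \<le> ennreal (h powr (1 - q)) * ennreal (\<gamma> y powr q)" for y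
  proof (cases "h < \<gamma> y")
    case True
    have "\<gamma> y = \<gamma> y powr (1 - q) * \<gamma> y powr q"
      using True \<open>h > 0\<close> by (simp add: powr_add[symmetric])
    also have "\<dots> \<le> h powr (1 - q) * \<gamma> y powr q"
      using True \<open>h > 0\<close> \<open>q \<ge> 1\<close> by (intro mult_right_mono powr_mono2') auto
    finally show ?thesis
      using True \<open>h > 0\<close> by (simp add: indicator_def ennreal_mult'[symmetric] ennreal_leI)
  qed (use \<open>h > 0\<close> in \<open>simp add: ennreal_less_iff\<close>)
  then have "(\<integral>\<^sup>+y. ennreal (\<gamma> y) * indicator {y. ennreal h < ennreal (\<gamma> y)} y \<partial>M)
     \<le> ennreal (h powr (1 - q)) * (\<integral>\<^sup>+y. ennreal (\<gamma> y powr q) \<partial>M)"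
    by (subst nn_integral_cmult[symmetric]) (auto intro!: nn_integral_mono)
  then have "ennreal (1 / h) * (\<integral>\<^sup>+y. ennreal (\<gamma> y) * indicator {y. ennreal h < ennreal (\<gamma> y)} y \<partial>M)
     \<le> ennreal (1 / h) * (ennreal (h powr (1 - q)) * (\<integral>\<^sup>+y. ennreal (\<gamma> y powr q) \<partial>M))"
    by (rule mult_left_mono) simp
  also have "\<dots> = ennreal (h powr - q) * (\<integral>\<^sup>+y. ennreal (\<gamma> y powr q) \<partial>M)"
  proof -
    have "1 / h * h powr (1 - q) = h powr - q"
      using \<open>h > 0\<close> by (simp add: powr_diff powr_minus field_simps)
    then show ?thesis
      using \<open>h > 0\<close> by (simp add: mult.assoc[symmetric] ennreal_mult'[symmetric])
  qed
  finally show ?thesis .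
qed

text \<open>Only an inequality: \<^const>\<open>enn2real\<close> sends \<open>\<infinity>\<close> to \<open>0\<close>. This suits the use below, where the Bochner
  integral is likewise \<open>0\<close> at points of non-integrability.\<close>

lemma enn2real_powr_layer_cake:
  assumes "a > 0"
  shows "ennreal (enn2real u powr a)
    \<le> (\<integral>\<^sup>+t. ennreal (a * t powr (a - 1)) * indicator {t. 0 < t \<and> ennreal t < u} t \<partial>lborel)"
proof -
  define x where "x = enn2real u"
  have "x \<ge> 0" by (simp add: x_def)
  have sub: "ennreal t < u" if "0 < t" "t < x" for t
    using that unfolding x_def by (cases u) (auto simp: ennreal_less_iff)
  have "ennreal (x powr a) = ennreal a * ennreal (x powr a / a)"
    using assms by (simp add: ennreal_mult'[symmetric])
  also have "\<dots> = (\<integral>\<^sup>+t. ennreal a * (ennreal (t powr (a - 1)) * indicator {0..x} t) \<partial>lborel)"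
    using nn_integral_powr_from_0[of "a - 1" x] assms \<open>x \<ge> 0\<close> by (simp add: nn_integral_cmult)
  \<comment> \<open>The integrands compare except possibly at the two points t = 0 and t = x, which
    form a null set.\<close>
  also have "\<dots> \<le> (\<integral>\<^sup>+t. ennreal (a * t powr (a - 1)) * indicator {t. 0 < t \<and> ennreal t < u} t \<partial>lborel)"
    by (rule nn_integral_mono_AE, rule AE_mp[OF AE_lborel_singleton[of 0]], rule AE_mp[OF AE_lborel_singleton[of x]])
       (use assms sub in \<open>auto simp: indicator_def ennreal_mult'[symmetric]\<close>)
  finally show ?thesis by (simp add: x_def)
qed

text \<open>Layer cake for U, then Tonelli. For fixed y the levels t that see \<gamma>(y) are those
  with c t^b < \<gamma>(y), so the inner integral of t^(bq-b-1) stops at X = (\<gamma>(y)/c)^(1/b)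
  and is a multiple of \<gamma>(y)^(q-1); the remaining factor \<gamma>(y) completes the q-th power.
  A cut-off height that moves with the level does the work of interpolation here.\<close>

lemma nn_integral_powr_of_distribution:
  fixes U :: "'a::euclidean_space \<Rightarrow> ennreal" and \<gamma> :: "'a \<Rightarrow> real"
  assumes [measurable]: "U \<in> borel_measurable borel" "\<gamma> \<in> borel_measurable borel"
    and \<gamma>: "\<And>y. \<gamma> y \<ge> 0" and pos: "b > 0" "c > 0" "q > 1"
    and dist: "\<And>\<tau>. \<tau> > 0 \<Longrightarrow> emeasure lborel {x. ennreal \<tau> < U x}
      \<le> ennreal (1 / (c * \<tau> powr b))
         * (\<integral>\<^sup>+y. ennreal (\<gamma> y) * indicator {y. ennreal (c * \<tau> powr b) < ennreal (\<gamma> y)} y \<partial>lborel)"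
  shows "(\<integral>\<^sup>+x. ennreal (enn2real (U x) powr (b * q)) \<partial>lborel)
    \<le> ennreal (q / (q - 1) * c powr - q) * (\<integral>\<^sup>+y. ennreal (\<gamma> y powr q) \<partial>lborel)"
proof -
  define a where "a = b * q"
  have "a > 0" using pos by (simp add: a_def)
  \<comment> \<open>The level enters the inner integral with exponent a - b - 1, so integrability at
    0 is exactly q > 1.\<close>
  have ab: "a - b = b * (q - 1)" by (simp add: a_def algebra_simps)
  then have "a - b > 0" using pos by simp
  let ?w = "\<lambda>t. ennreal (a * t powr (a - 1))"
  have "(\<integral>\<^sup>+x. ennreal (enn2real (U x) powr a) \<partial>lborel)
    \<le> (\<integral>\<^sup>+x. (\<integral>\<^sup>+t. ?w t * indicator {t. 0 < t \<and> ennreal t < U x} t \<partial>lborel) \<partial>lborel)"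
    by (intro nn_integral_mono enn2real_powr_layer_cake \<open>a > 0\<close>)
  also have "\<dots> = (\<integral>\<^sup>+t. (\<integral>\<^sup>+x. ?w t * indicator {t. 0 < t \<and> ennreal t < U x} t \<partial>lborel) \<partial>lborel)"
    by (rule lborel_pair.Fubini') measurable
  also have "\<dots> = (\<integral>\<^sup>+t. ?w t * indicator {0<..} t * emeasure lborel {x. ennreal t < U x} \<partial>lborel)"
  proof (rule nn_integral_cong)
    fix t
    have "(\<integral>\<^sup>+x. ?w t * indicator {t. 0 < t \<and> ennreal t < U x} t \<partial>lborel)
       = (\<integral>\<^sup>+x. ?w t * indicator {0<..} t * indicator {x. ennreal t < U x} x \<partial>lborel)"
      by (intro nn_integral_cong) (auto simp: indicator_def)
    also have "\<dots> = ?w t * indicator {0<..} t * emeasure lborel {x. ennreal t < U x}"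
      by (subst nn_integral_cmult_indicator) auto
    finally show "(\<integral>\<^sup>+x. ?w t * indicator {t. 0 < t \<and> ennreal t < U x} t \<partial>lborel) = \<dots>" .
  qed
  also have "\<dots> \<le> (\<integral>\<^sup>+t. (\<integral>\<^sup>+y. ennreal (a / c * t powr (a - b - 1)) * indicator {0<..} t
        * (ennreal (\<gamma> y) * indicator {y. ennreal (c * t powr b) < ennreal (\<gamma> y)} y) \<partial>lborel) \<partial>lborel)"
  proof (rule nn_integral_mono)
    fix t :: real
    show "?w t * indicator {0<..} t * emeasure lborel {x. ennreal t < U x}
      \<le> (\<integral>\<^sup>+y. ennreal (a / c * t powr (a - b - 1)) * indicator {0<..} t
        * (ennreal (\<gamma> y) * indicator {y. ennreal (c * t powr b) < ennreal (\<gamma> y)} y) \<partial>lborel)"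
    proof (cases "t > 0")
      case True
      have "?w t * emeasure lborel {x. ennreal t < U x} \<le> ?w t * (ennreal (1 / (c * t powr b))
         * (\<integral>\<^sup>+y. ennreal (\<gamma> y) * indicator {y. ennreal (c * t powr b) < ennreal (\<gamma> y)} y \<partial>lborel))"
        by (intro mult_left_mono dist True) simp
      also have "\<dots> = ennreal (a / c * t powr (a - b - 1))
         * (\<integral>\<^sup>+y. ennreal (\<gamma> y) * indicator {y. ennreal (c * t powr b) < ennreal (\<gamma> y)} y \<partial>lborel)"
      proof -
        have "a * t powr (a - 1) * (1 / (c * t powr b)) = a / c * t powr (a - b - 1)"
          using True by (simp add: powr_diff powr_add field_simps)
        then show ?thesis
          using \<open>a > 0\<close> by (simp add: mult.assoc[symmetric] ennreal_mult'[symmetric])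
      qed
      finally show ?thesis using True by (simp add: nn_integral_cmult)
    qed simp
  qed
  also have "\<dots> = (\<integral>\<^sup>+y. (\<integral>\<^sup>+t. ennreal (a / c * t powr (a - b - 1)) * indicator {0<..} t
        * (ennreal (\<gamma> y) * indicator {y. ennreal (c * t powr b) < ennreal (\<gamma> y)} y) \<partial>lborel) \<partial>lborel)"
    by (rule lborel_pair.Fubini') measurable
  also have "\<dots> \<le> (\<integral>\<^sup>+y. ennreal (q / (q - 1) * c powr - q) * ennreal (\<gamma> y powr q) \<partial>lborel)"
  proof (rule nn_integral_mono)
    fix y
    define X where "X = (\<gamma> y / c) powr (1 / b)"
    have "X \<ge> 0" by (simp add: X_def)
    have X: "t \<le> X" if "t > 0" "c * t powr b < \<gamma> y" for t
    proof -
      have "(t powr b) powr (1 / b) \<le> (\<gamma> y / c) powr (1 / b)"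
        using that pos by (intro powr_mono2) (auto simp: field_simps)
      then show ?thesis using that pos by (simp add: X_def powr_powr)
    qed
    have "(\<integral>\<^sup>+t. ennreal (a / c * t powr (a - b - 1)) * indicator {0<..} t
        * (ennreal (\<gamma> y) * indicator {y. ennreal (c * t powr b) < ennreal (\<gamma> y)} y) \<partial>lborel)
      \<le> (\<integral>\<^sup>+t. ennreal (\<gamma> y * a / c) * (ennreal (t powr (a - b - 1)) * indicator {0..X} t) \<partial>lborel)"
    proof (rule nn_integral_mono)
      fix t
      show "ennreal (a / c * t powr (a - b - 1)) * indicator {0<..} t
        * (ennreal (\<gamma> y) * indicator {y. ennreal (c * t powr b) < ennreal (\<gamma> y)} y)
       \<le> ennreal (\<gamma> y * a / c) * (ennreal (t powr (a - b - 1)) * indicator {0..X} t)"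
        using X[of t] \<open>a > 0\<close> pos \<gamma>[of y]
        by (cases "t > 0 \<and> c * t powr b < \<gamma> y")
           (auto simp: ennreal_less_iff ennreal_mult'[symmetric] mult_ac)
    qed
    also have "\<dots> = ennreal (\<gamma> y * a / c) * ennreal (X powr (a - b) / (a - b))"
      using nn_integral_powr_from_0[of "a - b - 1" X] \<open>a - b > 0\<close> \<open>X \<ge> 0\<close> by (simp add: nn_integral_cmult)
    also have "\<dots> = ennreal (q / (q - 1) * c powr - q) * ennreal (\<gamma> y powr q)"
    proof (cases "\<gamma> y = 0")
      case False
      then have "\<gamma> y > 0" using \<gamma>[of y] by simp
      have X_powr: "X powr (a - b) = \<gamma> y powr (q - 1) / c powr (q - 1)"
        using pos \<gamma>[of y] by (simp add: X_def ab powr_powr powr_divide)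
      have "\<gamma> y * a / c * (X powr (a - b) / (a - b))
          = q / (q - 1) * (1 / (c * c powr (q - 1))) * (\<gamma> y * \<gamma> y powr (q - 1))"
        using pos unfolding X_powr unfolding ab a_def
        by (simp add: divide_simps) (simp add: algebra_simps)
      also have "\<dots> = (q / (q - 1) * c powr - q) * \<gamma> y powr q"
        using pos \<open>\<gamma> y > 0\<close> by (simp add: powr_diff powr_minus field_simps)
      finally have "\<gamma> y * a / c * (X powr (a - b) / (a - b)) = (q / (q - 1) * c powr - q) * \<gamma> y powr q" .
      then have "ennreal (\<gamma> y * a / c * (X powr (a - b) / (a - b)))
          = ennreal ((q / (q - 1) * c powr - q) * \<gamma> y powr q)" by simp
      then show ?thesis
        using pos \<open>a > 0\<close> \<open>\<gamma> y > 0\<close> by (simp add: ennreal_mult'[symmetric])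
    qed simp
    finally show "(\<integral>\<^sup>+t. ennreal (a / c * t powr (a - b - 1)) * indicator {0<..} t
        * (ennreal (\<gamma> y) * indicator {y. ennreal (c * t powr b) < ennreal (\<gamma> y)} y) \<partial>lborel) \<le> \<dots>" .
  qed
  finally show ?thesis by (simp add: a_def nn_integral_cmult)
qed

section \<open>The distribution inequality for rough kernels\<close>

text \<open>The near hypothesis of the truncation estimate comes from scaling with weight exponent n
  - \<alpha>. For the far one, the pairing with a normalized \<gamma> is bounded by the L^q' norm of
  the kernel, finite because (n - \<alpha>) q' > n is equivalent to \<beta> > 0; for q = 1 the
  essential bound of w takes its place. The constant c depends on neither \<gamma> nor
  \<tau>.\<close>

lemma rough_kernel_distribution:
  fixes w :: "'a::euclidean_space \<Rightarrow> real" and \<alpha> \<beta> q :: real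
  assumes [measurable]: "w \<in> borel_measurable borel" and w: "\<And>z. w z \<ge> 0"
    and hom: "homogeneous_degree_zero w"
    and \<alpha>: "0 < \<alpha>" "\<alpha> < DIM('a)" and \<beta>: "\<beta> = DIM('a) / q - \<alpha>" "\<beta> > 0"
    and q: "(q = 1 \<and> (\<exists>M. AE z in lborel. w z \<le> M)) \<or>
      (q > 1 \<and> (\<integral>\<^sup>+z. ennreal (w z powr (q / (q - 1))) * indicator (ball 0 1) z \<partial>lborel) < top)"
  obtains c where "c > 0"
    "\<And>\<gamma> \<tau>. \<lbrakk>\<gamma> \<in> borel_measurable borel; \<And>y. \<gamma> y \<ge> 0; (\<integral>\<^sup>+y. ennreal (\<gamma> y powr q) \<partial>lborel) \<le> 1; \<tau> > 0\<rbrakk> \<Longrightarrow>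
       emeasure lborel {x. ennreal \<tau> < (\<integral>\<^sup>+y. ennreal (w (x - y) * norm (x - y) powr (\<alpha> - DIM('a))) * ennreal (\<gamma> y) \<partial>lborel)}
       \<le> ennreal (1 / (c * \<tau> powr (1 + \<alpha> / \<beta>)))
          * (\<integral>\<^sup>+y. ennreal (\<gamma> y) * indicator {y. ennreal (c * \<tau> powr (1 + \<alpha> / \<beta>)) < ennreal (\<gamma> y)} y \<partial>lborel)"
proof -
  let ?n = "real DIM('a)"
  define k where "k z = w z * norm z powr (\<alpha> - ?n)" for z
  have k_nonneg: "k z \<ge> 0" for z using w by (simp add: k_def)
  have [measurable]: "k \<in> borel_measurable borel" unfolding k_def by measurable
  have hom_ennreal: "homogeneous_degree_zero (\<lambda>z. ennreal (F (w z)))" for F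
    using hom by (simp add: homogeneous_degree_zero_def)
  have J: "(\<integral>\<^sup>+z. ennreal (w z) * indicator (ball 0 1) z \<partial>lborel) < top"
  proof -
    have fin: "emeasure lborel (ball (0::'a) 1) < top"
      using emeasure_lborel_ball_finite[of "0::'a" 1] by simp
    consider M where "AE z in lborel. w z \<le> M" |
      "q > 1" "(\<integral>\<^sup>+z. ennreal (w z powr (q / (q - 1))) * indicator (ball 0 1) z \<partial>lborel) < top"
      using q by blast
    then show ?thesis
    proof cases
      case 1
      then have "(\<integral>\<^sup>+z. ennreal (w z) * indicator (ball 0 1) z \<partial>lborel)
         \<le> (\<integral>\<^sup>+z. ennreal M * indicator (ball (0::'a) 1) z \<partial>lborel)"
        by (intro nn_integral_mono_AE) (auto simp: indicator_def ennreal_leI)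
      also have "\<dots> < top" using fin by (simp add: nn_integral_cmult_indicator ennreal_mult_less_top)
      finally show ?thesis .
    next
      case 2
      \<comment> \<open>On the unit ball, which has finite measure, L^q' is contained in
        L^1.\<close>
      have "w z \<le> 1 + w z powr (q / (q - 1))" for z
      proof (cases "w z \<le> 1")
        case False
        have "w z powr 1 \<le> w z powr (q / (q - 1))"
          using False 2 by (intro powr_mono) (auto simp: field_simps)
        then show ?thesis using False by simp
      qed (simp add: add_increasing2)
      then have "ennreal (w z) \<le> ennreal (1 + w z powr (q / (q - 1)))" for z
        by (rule ennreal_leI)
      then have "ennreal (w z) \<le> 1 + ennreal (w z powr (q / (q - 1)))" for z
        by simp
      then have "(\<integral>\<^sup>+z. ennreal (w z) * indicator (ball 0 1) z \<partial>lborel)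
         \<le> (\<integral>\<^sup>+z. indicator (ball 0 1) z + ennreal (w z powr (q / (q - 1))) * indicator (ball 0 1) z \<partial>lborel)"
        by (intro nn_integral_mono) (auto simp: indicator_def)
      also have "\<dots> = emeasure lborel (ball (0::'a) 1)
           + (\<integral>\<^sup>+z. ennreal (w z powr (q / (q - 1))) * indicator (ball 0 1) z \<partial>lborel)"
        by (subst nn_integral_add) (auto intro!: borel_measurable_times_ennreal borel_measurable_indicator)
      also have "\<dots> < top" using fin 2 by simp
      finally show ?thesis .
    qed
  qed
  obtain j where j: "j \<ge> 0" "(\<integral>\<^sup>+z. ennreal (w z) * indicator (ball 0 1) z \<partial>lborel) = ennreal j"
    using J by (metis enn2real_nonneg ennreal_enn2real)
  \<comment> \<open>The quotient n/\<alpha> is n/(n-a) for the weight exponent a = n - \<alpha>.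
    Adding 1 keeps A positive even when w vanishes almost everywhere.\<close>
  define A where "A = j * (?n / \<alpha>) + 1"
  have "A > 0" using \<alpha> j by (simp add: A_def add_nonneg_pos)
  have near: "(\<integral>\<^sup>+z. ennreal (k z) * indicator (ball 0 \<delta>) z \<partial>lborel) \<le> ennreal (A * \<delta> powr \<alpha>)"
    if "\<delta> > 0" for \<delta>
  proof -
    have "(\<integral>\<^sup>+z. ennreal (k z) * indicator (ball 0 \<delta>) z \<partial>lborel)
       = (\<integral>\<^sup>+z. ennreal (w z) * ennreal (norm z powr - (?n - \<alpha>)) * indicator (ball 0 \<delta>) z \<partial>lborel)"
      using w by (simp add: k_def ennreal_mult')
    also have "\<dots> \<le> (\<integral>\<^sup>+z. ennreal (w z) * indicator (ball 0 1) z \<partial>lborel)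
       * ennreal (?n / (?n - (?n - \<alpha>)) * \<delta> powr (?n - (?n - \<alpha>)))"
      using \<alpha> that by (intro nn_integral_homogeneous_near hom_ennreal[of "\<lambda>x. x"]) auto
    also have "\<dots> = ennreal ((A - 1) * \<delta> powr \<alpha>)"
      using j \<alpha> by (simp add: A_def ennreal_mult'[symmetric])
    also have "\<dots> \<le> ennreal (A * \<delta> powr \<alpha>)"
      by (intro ennreal_leI mult_right_mono) auto
    finally show ?thesis .
  qed
  have "\<exists>B>0. \<forall>\<gamma> \<delta> x. \<gamma> \<in> borel_measurable borel \<longrightarrow> (\<forall>y. \<gamma> y \<ge> 0) \<longrightarrow>
      (\<integral>\<^sup>+y. ennreal (\<gamma> y powr q) \<partial>lborel) \<le> 1 \<longrightarrow> \<delta> > 0 \<longrightarrow>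
      (\<integral>\<^sup>+y. ennreal (k (x - y)) * indicator (- ball 0 \<delta>) (x - y) * ennreal (\<gamma> y) \<partial>lborel)
        \<le> ennreal (B * \<delta> powr - \<beta>)"
    using q
  proof (elim disjE conjE exE)
    fix M assume "q = 1" and M: "AE z in lborel. w z \<le> M"
    define B where "B = \<bar>M\<bar> + 1"
    show ?thesis
    proof (intro exI[of _ B] conjI allI impI)
      show "B > 0" by (simp add: B_def)
      fix \<gamma> :: "'a \<Rightarrow> real" and \<delta> :: real and x :: 'a
      assume [measurable]: "\<gamma> \<in> borel_measurable borel" and \<gamma>: "\<forall>y. \<gamma> y \<ge> 0" and "\<delta> > 0"
        and norm: "(\<integral>\<^sup>+y. ennreal (\<gamma> y powr q) \<partial>lborel) \<le> 1"
      have AE: "AE y in lborel. w (x - y) \<le> M"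
        by (rule AE_lborel_reflect[OF M])
      have "(\<integral>\<^sup>+y. ennreal (k (x - y)) * indicator (- ball 0 \<delta>) (x - y) * ennreal (\<gamma> y) \<partial>lborel)
        \<le> (\<integral>\<^sup>+y. ennreal (B * \<delta> powr - \<beta>) * ennreal (\<gamma> y) \<partial>lborel)"
      proof (rule nn_integral_mono_AE, rule AE_mp[OF AE], intro AE_I2 impI mult_right_mono)
        fix y assume "w (x - y) \<le> M"
        show "ennreal (k (x - y)) * indicator (- ball 0 \<delta>) (x - y) \<le> ennreal (B * \<delta> powr - \<beta>)"
        proof (cases "x - y \<in> ball 0 \<delta>")
          case False
          have "norm (x - y) powr (\<alpha> - ?n) \<le> \<delta> powr (\<alpha> - ?n)"
            using False \<open>\<delta> > 0\<close> \<alpha> by (intro powr_mono2') auto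
          then have "k (x - y) \<le> B * \<delta> powr - \<beta>"
            unfolding k_def \<beta> \<open>q = 1\<close> using \<open>w (x - y) \<le> M\<close> w
            by (intro mult_mono) (auto simp: B_def)
          then show ?thesis using False by (simp add: ennreal_leI)
        qed simp
      qed simp
      also have "\<dots> \<le> ennreal (B * \<delta> powr - \<beta>) * 1"
        using norm \<gamma> \<open>q = 1\<close> by (subst nn_integral_cmult) (auto intro!: mult_left_mono simp del: mult_1_right)
      finally show "(\<integral>\<^sup>+y. ennreal (k (x - y)) * indicator (- ball 0 \<delta>) (x - y) * ennreal (\<gamma> y) \<partial>lborel)
        \<le> ennreal (B * \<delta> powr - \<beta>)" by simp
    qed
  next
    assume "q > 1" and fin: "(\<integral>\<^sup>+z. ennreal (w z powr (q / (q - 1))) * indicator (ball 0 1) z \<partial>lborel) < top"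
    define m where "m = q / (q - 1)"
    have "m > 1" and m: "1 / m + 1 / q = 1" using \<open>q > 1\<close> by (auto simp: m_def field_simps)
    \<comment> \<open>With m conjugate to q, this is the decay exponent of the m-th power of the
      kernel; by the next identity a > n amounts to \<beta> > 0.\<close>
    define a where "a = (?n - \<alpha>) * m"
    have exponent: "?n - a = - \<beta> * m"
      using \<open>q > 1\<close> by (simp add: a_def m_def \<beta> divide_simps) (simp add: algebra_simps)
    then have "a > ?n" using \<beta> \<open>m > 1\<close> by (smt (verit) mult_minus_left mult_pos_pos)
    obtain d where d: "d \<ge> 0" "(\<integral>\<^sup>+z. ennreal (w z powr m) * indicator (ball 0 1) z \<partial>lborel) = ennreal d"
      using fin unfolding m_def by (metis enn2real_nonneg ennreal_enn2real)
    \<comment> \<open>D controls the m-th power integral of the far kernel, so its m-th root B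
      controls the norm; the added 1 again ensures positivity.\<close>
    define D where "D = d * (a / (a - ?n)) + 1"
    have "a > 0" using \<open>a > ?n\<close> by (rule less_trans[rotated]) simp
    then have "D > 0" using \<open>a > ?n\<close> d by (simp add: D_def add_nonneg_pos)
    define B where "B = D powr (1 / m)"
    have B_m: "B powr m = D" using \<open>D > 0\<close> \<open>m > 1\<close> by (simp add: B_def powr_powr)
    have far_power: "(\<integral>\<^sup>+z. ennreal (k z powr m) * indicator (- ball 0 \<delta>) z \<partial>lborel) \<le> ennreal ((B * \<delta> powr - \<beta>) powr m)"
      if "\<delta> > 0" for \<delta>
    proof -
      have "k z powr m = w z powr m * norm z powr - a" for z
        using w by (simp add: k_def powr_mult powr_powr a_def left_diff_distrib)
      then have "(\<integral>\<^sup>+z. ennreal (k z powr m) * indicator (- ball 0 \<delta>) z \<partial>lborel)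
         = (\<integral>\<^sup>+z. ennreal (w z powr m) * ennreal (norm z powr - a) * indicator (- ball 0 \<delta>) z \<partial>lborel)"
        by (simp add: ennreal_mult')
      also have "\<dots> \<le> (\<integral>\<^sup>+z. ennreal (w z powr m) * indicator (ball 0 1) z \<partial>lborel)
         * ennreal (a / (a - ?n) * \<delta> powr (?n - a))"
        using \<open>a > ?n\<close> that by (intro nn_integral_homogeneous_far hom_ennreal[of "\<lambda>x. x powr m"]) auto
      also have "\<dots> = ennreal ((D - 1) * \<delta> powr (?n - a))"
        using d \<open>a > ?n\<close> \<open>a > 0\<close> by (simp add: D_def ennreal_mult'[symmetric])
      also have "\<dots> \<le> ennreal (D * \<delta> powr (?n - a))"
        by (intro ennreal_leI mult_right_mono) auto
      also have "D * \<delta> powr (?n - a) = (B * \<delta> powr - \<beta>) powr m"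
        using B_m \<open>\<delta> > 0\<close> unfolding exponent by (subst powr_mult) (auto simp: B_def powr_powr)
      finally show ?thesis .
    qed
    show ?thesis
    proof (intro exI[of _ B] conjI allI impI)
      show "B > 0" using \<open>D > 0\<close> by (simp add: B_def)
      fix \<gamma> :: "'a \<Rightarrow> real" and \<delta> :: real and x :: 'a
      assume [measurable]: "\<gamma> \<in> borel_measurable borel" and \<gamma>: "\<forall>y. \<gamma> y \<ge> 0" and "\<delta> > 0"
        and norm: "(\<integral>\<^sup>+y. ennreal (\<gamma> y powr q) \<partial>lborel) \<le> 1"
      \<comment> \<open>The bound to be reached. Young's inequality for k/\<mu> and \<gamma>,
        multiplied by \<mu>, bounds the pairing by \<mu>/m + \<mu>/q = \<mu>: Hoelder's inequality
        in normalized form.\<close>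
      define \<mu> where "\<mu> = B * \<delta> powr - \<beta>"
      have "\<mu> > 0" using \<open>B > 0\<close> \<open>\<delta> > 0\<close> by (simp add: \<mu>_def)
      let ?P = "\<lambda>z. ennreal (k z powr m) * indicator (- ball 0 \<delta>) z"
      have [measurable]: "?P \<in> borel_measurable borel"
        by (intro borel_measurable_times_ennreal borel_measurable_indicator) auto
      have "(\<integral>\<^sup>+y. ennreal (k (x - y)) * indicator (- ball 0 \<delta>) (x - y) * ennreal (\<gamma> y) \<partial>lborel)
        \<le> (\<integral>\<^sup>+y. ennreal (\<mu> powr (1 - m) / m) * ?P (x - y) + ennreal (\<mu> / q) * ennreal (\<gamma> y powr q) \<partial>lborel)"
      proof (rule nn_integral_mono)
        fix y
        have "k (x - y) * \<gamma> y = \<mu> * (k (x - y) / \<mu> * \<gamma> y)"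
          using \<open>\<mu> > 0\<close> by simp
        also have "\<dots> \<le> \<mu> * ((k (x - y) / \<mu>) powr m / m + \<gamma> y powr q / q)"
          using \<open>\<mu> > 0\<close> \<open>m > 1\<close> \<open>q > 1\<close> m \<gamma> k_nonneg by (intro mult_left_mono Youngs_inequality) auto
        also have "\<dots> = \<mu> powr (1 - m) / m * k (x - y) powr m + \<mu> / q * \<gamma> y powr q"
          using \<open>\<mu> > 0\<close> k_nonneg by (simp add: powr_divide powr_diff algebra_simps)
        finally have "ennreal (k (x - y)) * ennreal (\<gamma> y)
           \<le> ennreal (\<mu> powr (1 - m) / m) * ennreal (k (x - y) powr m) + ennreal (\<mu> / q) * ennreal (\<gamma> y powr q)"
          using \<open>\<mu> > 0\<close> \<open>m > 1\<close> \<open>q > 1\<close> k_nonneg \<gamma>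
          by (simp add: ennreal_mult'[symmetric] ennreal_plus[symmetric] ennreal_leI del: ennreal_plus)
        then show "ennreal (k (x - y)) * indicator (- ball 0 \<delta>) (x - y) * ennreal (\<gamma> y)
           \<le> ennreal (\<mu> powr (1 - m) / m) * ?P (x - y) + ennreal (\<mu> / q) * ennreal (\<gamma> y powr q)"
          by (auto simp: indicator_def)
      qed
      also have "\<dots> = ennreal (\<mu> powr (1 - m) / m) * (\<integral>\<^sup>+y. ?P (x - y) \<partial>lborel)
          + ennreal (\<mu> / q) * (\<integral>\<^sup>+y. ennreal (\<gamma> y powr q) \<partial>lborel)"
        by (subst nn_integral_add, measurable) (simp add: nn_integral_cmult)
      also have "(\<integral>\<^sup>+y. ?P (x - y) \<partial>lborel) = (\<integral>\<^sup>+y. ?P y \<partial>lborel)"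
        by (rule nn_integral_lborel_reflect) measurable
      also have "ennreal (\<mu> powr (1 - m) / m) * (\<integral>\<^sup>+y. ?P y \<partial>lborel)
          + ennreal (\<mu> / q) * (\<integral>\<^sup>+y. ennreal (\<gamma> y powr q) \<partial>lborel)
        \<le> ennreal (\<mu> powr (1 - m) / m) * ennreal (\<mu> powr m) + ennreal (\<mu> / q) * 1"
        using far_power[OF \<open>\<delta> > 0\<close>] norm by (intro add_mono mult_left_mono) (auto simp: \<mu>_def)
      also have "\<dots> = ennreal \<mu>"
      proof -
        have "\<mu> powr (1 - m) / m * \<mu> powr m + \<mu> / q = \<mu> * (1 / m + 1 / q)"
          using \<open>\<mu> > 0\<close> by (simp add: powr_diff algebra_simps)
        then show ?thesis
          using m \<open>\<mu> > 0\<close> \<open>m > 1\<close> \<open>q > 1\<close>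
          by (simp add: ennreal_mult'[symmetric] ennreal_plus[symmetric] del: ennreal_plus)
      qed
      finally show "(\<integral>\<^sup>+y. ennreal (k (x - y)) * indicator (- ball 0 \<delta>) (x - y) * ennreal (\<gamma> y) \<partial>lborel)
        \<le> ennreal (B * \<delta> powr - \<beta>)" by (simp add: \<mu>_def)
    qed
  qed
  then obtain B where "B > 0" and far: "\<And>\<gamma> \<delta> x. \<lbrakk>\<gamma> \<in> borel_measurable borel; \<And>y. \<gamma> y \<ge> 0;
      (\<integral>\<^sup>+y. ennreal (\<gamma> y powr q) \<partial>lborel) \<le> 1; \<delta> > 0\<rbrakk> \<Longrightarrow>
      (\<integral>\<^sup>+y. ennreal (k (x - y)) * indicator (- ball 0 \<delta>) (x - y) * ennreal (\<gamma> y) \<partial>lborel)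
        \<le> ennreal (B * \<delta> powr - \<beta>)"
    by blast
  \<comment> \<open>The coefficient of the power of \<tau> in the cut-off height h of the truncation
    estimate.\<close>
  define c where "c = (3 * B) powr - (\<alpha> / \<beta>) / (3 * A)"
  show thesis
  proof (rule that[of c])
    show "c > 0" using \<open>A > 0\<close> \<open>B > 0\<close> by (simp add: c_def)
    fix \<gamma> :: "'a \<Rightarrow> real" and \<tau> :: real
    assume \<gamma>: "\<gamma> \<in> borel_measurable borel" "\<And>y. \<gamma> y \<ge> 0" "(\<integral>\<^sup>+y. ennreal (\<gamma> y powr q) \<partial>lborel) \<le> 1"
      and "\<tau> > 0"
    show "emeasure lborel {x. ennreal \<tau> < (\<integral>\<^sup>+y. ennreal (w (x - y) * norm (x - y) powr (\<alpha> - ?n)) * ennreal (\<gamma> y) \<partial>lborel)}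
       \<le> ennreal (1 / (c * \<tau> powr (1 + \<alpha> / \<beta>)))
          * (\<integral>\<^sup>+y. ennreal (\<gamma> y) * indicator {y. ennreal (c * \<tau> powr (1 + \<alpha> / \<beta>)) < ennreal (\<gamma> y)} y \<partial>lborel)"
      unfolding k_def[symmetric] c_def
      using \<open>A > 0\<close> \<open>B > 0\<close> \<open>\<beta> > 0\<close> \<open>\<tau> > 0\<close> \<gamma>
      by (intro truncated_convolution_distribution[where \<alpha> = \<alpha> and \<beta> = \<beta> and A = A and B = B] near far) auto
  qed
qed

section \<open>Functions on the sphere\<close>

lemma completion_ex_borel_measurable_complex:
  fixes g :: "'a \<Rightarrow> complex"
  assumes "g \<in> borel_measurable (completion M)"
  obtains g' where "g' \<in> borel_measurable M" "AE x in M. g x = g' x"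
proof -
  have "(\<lambda>x. Re (g x)) \<in> borel_measurable (completion M)" "(\<lambda>x. Im (g x)) \<in> borel_measurable (completion M)"
    using assms by auto
  from this[THEN completion_ex_borel_measurable_real]
  obtain u v where [measurable]: "u \<in> borel_measurable M" "v \<in> borel_measurable M"
    and AE: "AE x in M. Re (g x) = u x" "AE x in M. Im (g x) = v x"
    by blast
  have "AE x in M. g x = complex_of_real (u x) + \<i> * complex_of_real (v x)"
    using AE by eventually_elim (simp add: complex_eq_iff)
  moreover have "(\<lambda>x. complex_of_real (u x) + \<i> * complex_of_real (v x)) \<in> borel_measurable M"
    by measurable
  ultimately show thesis using that by blast
qed

lemma borel_measurable_sgn_euclidean [measurable]:
  "(sgn :: 'a::euclidean_space \<Rightarrow> 'a) \<in> borel_measurable borel"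
proof -
  have "(\<lambda>x::'a. x /\<^sub>R norm x) \<in> borel_measurable borel"
    by measurable
  then show ?thesis by (simp add: sgn_div_norm[abs_def])
qed

text \<open>The sphere measure before completion: functions measurable for it are Borel on the
  sphere, and almost everywhere statements for \<open>sphere_measure\<close> reduce to it.\<close>

abbreviation sphere_base :: "'a::euclidean_space measure" where
  "sphere_base \<equiv> scale_measure (1 / emeasure lborel (ball (0::'a) 1))
      (distr (restrict_space lborel (ball 0 1 - {0})) (restrict_space borel (sphere 0 1)) sgn)"

lemma homogeneous_degree_zero_sgn:
  fixes \<phi> :: "'a::real_normed_vector \<Rightarrow> 'b"
  shows "homogeneous_degree_zero (\<lambda>z. \<phi> (sgn z))"
  by (simp add: homogeneous_degree_zero_def sgn_scaleR)

lemma homogeneous_degree_zero_sgn_eq: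
  fixes \<Omega> :: "'a::real_normed_vector \<Rightarrow> 'b"
  assumes "homogeneous_degree_zero \<Omega>" "z \<noteq> 0"
  shows "\<Omega> (sgn z) = \<Omega> z"
  using assms by (simp add: homogeneous_degree_zero_def sgn_div_norm)

text \<open>A null subset of the sphere spans a cone that is null in the unit ball, because
  \<open>sphere_measure\<close> is defined through cones. The indicator of the cone is homogeneous
  of degree zero, so by dilation the cone is null in every ball, and countably many balls cover the
  space.\<close>

lemma AE_sphere_measure_sgn:
  assumes "AE \<sigma> in sphere_measure. P (\<sigma> :: 'a::euclidean_space)"
  shows "AE z in lborel. z \<noteq> 0 \<longrightarrow> P (sgn z)"
proof -
  have "AE \<sigma> in sphere_base. P (\<sigma> :: 'a)"
    using assms unfolding sphere_measure_def AE_completion_iff .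
  then obtain N where N: "{\<sigma> \<in> space sphere_base. \<not> P \<sigma>} \<subseteq> N" "N \<in> null_sets (sphere_base :: 'a measure)"
    unfolding eventually_ae_filter by blast
  have bad: "\<sigma> \<in> N" if "\<sigma> \<in> sphere 0 1" "\<not> P \<sigma>" for \<sigma>
    using N(1) that by (auto simp: space_restrict_space space_scale_measure)
  have "N \<in> sets (restrict_space borel (sphere (0::'a) 1))"
    using N(2) by (auto simp: null_sets_def)
  then have borel: "N \<in> sets borel" and sub: "N \<subseteq> sphere 0 1"
    by (auto simp: sets_restrict_space_iff)
  have "emeasure (sphere_measure :: 'a measure) N = 0"
    using null_sets_completionI[OF N(2)] unfolding sphere_measure_def by auto
  then have zero: "emeasure lborel {z \<in> ball 0 1 - {0}. sgn z \<in> N} = 0"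
    using emeasure_sphere_measure[OF borel sub] emeasure_lborel_ball_finite[of "0::'a" 1]
    by (auto simp: ennreal_divide_eq_0_iff)
  let ?v = "\<lambda>z. indicator N (sgn z) :: ennreal"
  have [measurable]: "N \<in> sets borel" by (rule borel)
  have v: "?v \<in> borel_measurable borel"
    by measurable
  have ball: "(\<integral>\<^sup>+z. ?v z * indicator (ball 0 1) z \<partial>lborel) = 0"
  proof -
    have "(\<integral>\<^sup>+z. ?v z * indicator (ball 0 1) z \<partial>lborel) = (\<integral>\<^sup>+z. indicator {z \<in> ball 0 1 - {0}. sgn z \<in> N} z \<partial>lborel)"
      using sub by (intro nn_integral_cong) (auto simp: indicator_def)
    also have "\<dots> = emeasure lborel {z \<in> ball 0 1 - {0}. sgn z \<in> N}"
      by (rule nn_integral_indicator) measurable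
    finally show ?thesis using zero by simp
  qed
  have "AE z in lborel. ?v z * indicator (ball 0 (real (Suc j))) z = 0" for j
  proof -
    have "(\<integral>\<^sup>+z. ?v z * indicator (ball 0 (real (Suc j))) z \<partial>lborel) = 0"
      using nn_integral_homogeneous_ball[OF v homogeneous_degree_zero_sgn, of "real (Suc j)"] ball by simp
    then show ?thesis
      using v by (subst (asm) nn_integral_0_iff_AE)
        (auto intro!: borel_measurable_times_ennreal borel_measurable_indicator)
  qed
  then have "AE z in lborel. \<forall>j. ?v z * indicator (ball 0 (real (Suc j))) z = 0"
    by (subst AE_all_countable) blast
  then show ?thesis
  proof (rule AE_mp, intro AE_I2 impI)
    fix z :: 'a assume z: "\<forall>j. ?v z * indicator (ball 0 (real (Suc j))) z = 0" and "z \<noteq> 0"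
    obtain j where "norm z < real j"
      using reals_Archimedean2[of "norm z"] by blast
    then have "sgn z \<notin> N"
      using z[rule_format, of j] by (simp add: indicator_def split: if_splits)
    then show "P (sgn z)"
      using bad[of "sgn z"] \<open>z \<noteq> 0\<close> by (auto simp: norm_sgn)
  qed
qed

lemma nn_integral_sphere_measure:
  fixes \<phi> :: "'a::euclidean_space \<Rightarrow> ennreal"
  assumes [measurable]: "\<phi> \<in> borel_measurable borel"
  shows "(\<integral>\<^sup>+\<sigma>. \<phi> \<sigma> \<partial>sphere_measure)
    = 1 / emeasure lborel (ball (0::'a) 1) * (\<integral>\<^sup>+z. \<phi> (sgn z) * indicator (ball 0 1 - {0}) z \<partial>lborel)"
proof -
  have \<phi>: "\<phi> \<in> borel_measurable (restrict_space borel (sphere 0 1))"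
    by (rule measurable_restrict_space1) measurable
  then show ?thesis
    unfolding sphere_measure_def nn_integral_completion
    by (subst nn_integral_scale_measure)
       (auto simp: nn_integral_distr[OF measurable_sgn_sphere] nn_integral_restrict_space)
qed

text \<open>On the sphere, \<Omega> is measurable only for the completed measure. A Borel version
  there, extended by 0 and composed with \<open>sgn\<close>, is Borel and homogeneous on the whole
  space, and agrees with \<Omega> almost everywhere because \<Omega> is homogeneous as well. The
  hypothesis on s says that s is at least the exponent conjugate to q, so integrability passes down
  to that exponent on the unit ball.\<close>

lemma sphere_Lp_representative:
  fixes \<Omega> :: "'a::euclidean_space \<Rightarrow> complex" and q :: real
  assumes \<Omega>: "\<Omega> \<in> Lp_space sphere_measure s" and hom: "homogeneous_degree_zero \<Omega>"
    and q: "q \<ge> 1" and s: "s = top \<or> (q > 1 \<and> (\<exists>\<sigma>. s = ennreal \<sigma> \<and> q / (q - 1) \<le> \<sigma>))"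
  obtains \<Omega>' where "\<Omega>' \<in> borel_measurable borel" "homogeneous_degree_zero \<Omega>'"
    "AE z in lborel. \<Omega> z = \<Omega>' z"
    "(q = 1 \<and> (\<exists>M. AE z in lborel. norm (\<Omega>' z) \<le> M)) \<or>
      (q > 1 \<and> (\<integral>\<^sup>+z. ennreal (norm (\<Omega>' z) powr (q / (q - 1))) * indicator (ball 0 1) z \<partial>lborel) < top)"
proof -
  have "\<Omega> \<in> borel_measurable (completion sphere_base)"
    using \<Omega> by (simp add: Lp_space_def sphere_measure_def)
  then obtain \<omega> where \<omega>: "\<omega> \<in> borel_measurable (sphere_base :: 'a measure)" "AE \<sigma> in sphere_base. \<Omega> \<sigma> = \<omega> \<sigma>"
    by (rule completion_ex_borel_measurable_complex)
  \<comment> \<open>The indicator factor extends a function measurable on the sphere to a Borel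
    function on the whole space.\<close>
  define \<eta> where "\<eta> \<sigma> = indicator (sphere 0 1) \<sigma> *\<^sub>R \<omega> \<sigma>" for \<sigma>
  have "\<omega> \<in> borel_measurable (restrict_space borel (sphere 0 1))"
    using \<omega>(1) by (simp add: measurable_def space_scale_measure)
  then have [measurable]: "\<eta> \<in> borel_measurable borel"
    unfolding \<eta>_def by (subst (asm) borel_measurable_restrict_space_iff) auto
  have "AE \<sigma> in sphere_base. \<sigma> \<in> sphere (0::'a) 1"
    by (rule AE_I2) (auto simp: space_restrict_space space_scale_measure)
  with \<omega>(2) have "AE \<sigma> in sphere_base. \<Omega> \<sigma> = \<eta> \<sigma>"
    by eventually_elim (simp add: \<eta>_def)
  then have \<eta>: "AE \<sigma> in sphere_measure. \<Omega> \<sigma> = \<eta> \<sigma>"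
    unfolding sphere_measure_def by (rule AE_completion)
  define \<Omega>' where "\<Omega>' z = \<eta> (sgn z)" for z
  have \<Omega>'_borel [measurable]: "\<Omega>' \<in> borel_measurable borel"
    unfolding \<Omega>'_def by measurable
  have AE: "AE z in lborel. \<Omega> z = \<Omega>' z"
    using AE_sphere_measure_sgn[OF \<eta>] AE_lborel_singleton[of 0]
    by eventually_elim (simp add: \<Omega>'_def homogeneous_degree_zero_sgn_eq[OF hom])
  show thesis
  proof (rule that[OF \<Omega>'_borel _ AE])
    show "homogeneous_degree_zero \<Omega>'"
      unfolding \<Omega>'_def by (rule homogeneous_degree_zero_sgn)
    let ?m = "q / (q - 1)"
    have vol: "emeasure lborel (ball (0::'a) 1) < top"
      using emeasure_lborel_ball_finite[of "0::'a" 1] by simp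
    have norm: "Lp_norm sphere_measure s \<Omega> < top" using \<Omega> by (simp add: Lp_space_def)
    from s show "(q = 1 \<and> (\<exists>M. AE z in lborel. norm (\<Omega>' z) \<le> M)) \<or>
      (q > 1 \<and> (\<integral>\<^sup>+z. ennreal (norm (\<Omega>' z) powr ?m) * indicator (ball 0 1) z \<partial>lborel) < top)"
    proof (elim disjE conjE exE)
      assume "s = top"
      then have "esssup sphere_measure (\<lambda>\<sigma>. ennreal (norm (\<Omega> \<sigma>))) < top"
        using norm by (simp add: Lp_norm_def)
      then obtain M where M: "M \<ge> 0" "esssup sphere_measure (\<lambda>\<sigma>. ennreal (norm (\<Omega> \<sigma>))) = ennreal M"
        by (metis enn2real_nonneg ennreal_enn2real)
      have "AE \<sigma> in sphere_measure. norm (\<Omega> \<sigma>) \<le> M"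
        using esssup_AE[of "\<lambda>\<sigma>. ennreal (norm (\<Omega> \<sigma>))" sphere_measure] M by auto
      from AE_sphere_measure_sgn[OF this] AE AE_lborel_singleton[of 0]
      have bound: "AE z in lborel. norm (\<Omega>' z) \<le> M"
        by eventually_elim (simp add: homogeneous_degree_zero_sgn_eq[OF hom])
      show ?thesis
      proof (cases "q = 1")
        case False
        have "(\<integral>\<^sup>+z. ennreal (norm (\<Omega>' z) powr ?m) * indicator (ball 0 1) z \<partial>lborel)
          \<le> (\<integral>\<^sup>+z. ennreal (M powr ?m) * indicator (ball (0::'a) 1) z \<partial>lborel)"
        proof (rule nn_integral_mono_AE, rule AE_mp[OF bound], intro AE_I2 impI mult_right_mono ennreal_leI)
          fix z assume "norm (\<Omega>' z) \<le> M"
          then show "norm (\<Omega>' z) powr ?m \<le> M powr ?m"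
            using q by (intro powr_mono2) auto
        qed simp
        also have "\<dots> < top"
          using vol by (simp add: nn_integral_cmult_indicator ennreal_mult_less_top)
        finally show ?thesis using False q by auto
      qed (use bound in blast)
    next
      fix \<sigma> assume "q > 1" "s = ennreal \<sigma>" and \<sigma>: "?m \<le> \<sigma>"
      have "?m > 0" using \<open>q > 1\<close> by simp
      then have "\<sigma> > 0" using \<sigma> by linarith
      have "(\<integral>\<^sup>+x. ennreal (norm (\<Omega> x) powr \<sigma>) \<partial>sphere_measure) < top"
        using norm \<open>\<sigma> > 0\<close> unfolding \<open>s = ennreal \<sigma>\<close>
        by (simp add: Lp_norm_def ennreal_powr_def split: if_splits) (simp add: less_top)
      also have "(\<integral>\<^sup>+x. ennreal (norm (\<Omega> x) powr \<sigma>) \<partial>sphere_measure)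
          = (\<integral>\<^sup>+x. ennreal (norm (\<eta> x) powr \<sigma>) \<partial>sphere_measure)"
        using \<eta> by (intro nn_integral_cong_AE) auto
      also have "\<dots> = 1 / emeasure lborel (ball (0::'a) 1)
          * (\<integral>\<^sup>+z. ennreal (norm (\<Omega>' z) powr \<sigma>) * indicator (ball 0 1 - {0}) z \<partial>lborel)"
        unfolding \<Omega>'_def by (rule nn_integral_sphere_measure) measurable
      finally have fin: "(\<integral>\<^sup>+z. ennreal (norm (\<Omega>' z) powr \<sigma>) * indicator (ball 0 1 - {0}) z \<partial>lborel) < top"
        using vol by (auto simp: ennreal_mult_less_top divide_ennreal_def)
      have "(\<integral>\<^sup>+z. ennreal (norm (\<Omega>' z) powr ?m) * indicator (ball 0 1) z \<partial>lborel)
        \<le> (\<integral>\<^sup>+z. indicator (ball 0 1) z + ennreal (norm (\<Omega>' z) powr \<sigma>) * indicator (ball 0 1 - {0}) z \<partial>lborel)"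
      proof (rule nn_integral_mono_AE, rule AE_mp[OF AE_lborel_singleton[of 0]], intro AE_I2 impI)
        fix z :: 'a assume "z \<noteq> 0"
        \<comment> \<open>This gives the inclusion of L^\<sigma> in L^q' on the unit ball, whose
          measure is finite.\<close>
        have "norm (\<Omega>' z) powr ?m \<le> 1 + norm (\<Omega>' z) powr \<sigma>"
        proof (cases "norm (\<Omega>' z) \<le> 1")
          case True
          then have "norm (\<Omega>' z) powr ?m \<le> 1"
            using \<open>?m > 0\<close> by (intro powr_le1) auto
          then show ?thesis by (simp add: add_increasing2)
        next
          case False
          then have "norm (\<Omega>' z) powr ?m \<le> norm (\<Omega>' z) powr \<sigma>"
            using \<sigma> by (intro powr_mono) auto
          then show ?thesis by simp
        qed
        then have "ennreal (norm (\<Omega>' z) powr ?m) \<le> ennreal (1 + norm (\<Omega>' z) powr \<sigma>)"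
          by (rule ennreal_leI)
        then show "ennreal (norm (\<Omega>' z) powr ?m) * indicator (ball 0 1) z
          \<le> indicator (ball 0 1) z + ennreal (norm (\<Omega>' z) powr \<sigma>) * indicator (ball 0 1 - {0}) z"
          using \<open>z \<noteq> 0\<close> by (auto simp: indicator_def)
      qed
      also have "\<dots> = emeasure lborel (ball (0::'a) 1)
          + (\<integral>\<^sup>+z. ennreal (norm (\<Omega>' z) powr \<sigma>) * indicator (ball 0 1 - {0}) z \<partial>lborel)"
        by (subst nn_integral_add) (auto intro!: borel_measurable_times_ennreal borel_measurable_indicator)
      also have "\<dots> < top" using vol fin by simp
      finally show ?thesis using \<open>q > 1\<close> by blast
    qed
  qed
qed

section \<open>The rough fractional integral\<close>

text \<open>For each fixed x the two integrands differ only on a null set of y, part of which is the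
  reflected null set of the kernel. Hence nothing changes at any x, and the problem moves to Borel
  functions, where Tonelli's theorem and joint measurability apply.\<close>

lemma rough_fractional_integral_version:
  fixes \<Omega> \<Omega>' g g' :: "'a::euclidean_space \<Rightarrow> complex"
  assumes [measurable]: "\<Omega>' \<in> borel_measurable borel" "g' \<in> borel_measurable borel"
    and "AE z in lborel. \<Omega> z = \<Omega>' z" "AE y in lborel. g y = g' y"
  shows "rough_fractional_integral_exists \<Omega> \<alpha> g x \<longleftrightarrow> integrable lborel (\<lambda>y. rough_kernel \<Omega>' \<alpha> (x - y) * g' y)"
    and "rough_fractional_integral \<Omega> \<alpha> g x = (LINT y|lborel. rough_kernel \<Omega>' \<alpha> (x - y) * g' y)"
proof -
  let ?F = "\<lambda>y. rough_kernel \<Omega> \<alpha> (x - y) * g y" and ?F' = "\<lambda>y. rough_kernel \<Omega>' \<alpha> (x - y) * g' y"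
  have [measurable]: "?F' \<in> borel_measurable borel" unfolding rough_kernel_def by measurable
  have "AE y in lborel. ?F y = ?F' y"
    using AE_lborel_reflect[OF assms(3), of x] assms(4) by eventually_elim (simp add: rough_kernel_def)
  then have AE: "AE y in lebesgue. ?F y = ?F' y" by (rule AE_completion)
  have F': "?F' \<in> borel_measurable lebesgue" by (rule measurable_completion) simp
  then have F: "?F \<in> borel_measurable lebesgue"
    by (rule borel_measurable_AE) (use AE in auto)
  show "rough_fractional_integral_exists \<Omega> \<alpha> g x \<longleftrightarrow> integrable lborel ?F'"
    unfolding rough_fractional_integral_exists_def integrable_cong_AE[OF F F' AE]
    by (rule integrable_completion) simp
  show "rough_fractional_integral \<Omega> \<alpha> g x = (LINT y|lborel. ?F' y)"
    unfolding rough_fractional_integral_def integral_cong_AE[OF F F' AE]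
    by (rule integral_completion) simp
qed

text \<open>Everything is read off from U, the integral of the modulus, which is finite exactly
  where the integral exists and dominates its modulus everywhere. The distribution inequality for U
  gives the weak bound, letting the level tend to infinity gives existence almost everywhere, and
  integrating over the levels gives the strong bound for q > 1.\<close>

lemma rough_fractional_integral_bounds:
  fixes \<Omega> \<Omega>' :: "'a::euclidean_space \<Rightarrow> complex" and \<alpha> \<beta> q :: real
  assumes [measurable]: "\<Omega>' \<in> borel_measurable borel"
    and hom: "homogeneous_degree_zero \<Omega>'" and \<Omega>: "AE z in lborel. \<Omega> z = \<Omega>' z"
    and \<alpha>: "0 < \<alpha>" "\<alpha> < DIM('a)" and \<beta>: "\<beta> = DIM('a) / q - \<alpha>" "\<beta> > 0"
    and q: "(q = 1 \<and> (\<exists>M. AE z in lborel. norm (\<Omega>' z) \<le> M)) \<or>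
      (q > 1 \<and> (\<integral>\<^sup>+z. ennreal (norm (\<Omega>' z) powr (q / (q - 1))) * indicator (ball 0 1) z \<partial>lborel) < top)"
  obtains D where "D > 0"
    "\<And>g. \<lbrakk>g \<in> borel_measurable lebesgue; (\<integral>\<^sup>+y. ennreal (norm (g y) powr q) \<partial>lebesgue) \<le> 1\<rbrakk> \<Longrightarrow>
      (AE x in lebesgue. rough_fractional_integral_exists \<Omega> \<alpha> g x) \<and>
      rough_fractional_integral \<Omega> \<alpha> g \<in> borel_measurable lebesgue \<and>
      (\<forall>\<tau>>0. emeasure lebesgue {x. \<tau> < norm (rough_fractional_integral \<Omega> \<alpha> g x)}
        \<le> ennreal (D * \<tau> powr - (DIM('a) / \<beta>))) \<and>
      (q > 1 \<longrightarrow> (\<integral>\<^sup>+x. ennreal (norm (rough_fractional_integral \<Omega> \<alpha> g x) powr (DIM('a) / \<beta>)) \<partial>lebesgue) \<le> ennreal D)"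
proof -
  let ?n = "real DIM('a)"
  have "q \<ge> 1" using q by auto
  define b where "b = 1 + \<alpha> / \<beta>"
  have "b > 0" using \<alpha> \<beta> by (simp add: b_def add_pos_pos)
  \<comment> \<open>Since \<beta> + \<alpha> = n/q. Thus the cut-off height c \<tau>^b, raised to
    the power -q, decays like \<tau>^-(n/\<beta>).\<close>
  have bq: "b * q = ?n / \<beta>"
  proof -
    have "(\<beta> + \<alpha>) * q = ?n" using \<open>q \<ge> 1\<close> by (simp add: \<beta>)
    then show ?thesis using \<open>\<beta> > 0\<close> by (simp add: b_def field_simps)
  qed
  have hom': "homogeneous_degree_zero (\<lambda>z. norm (\<Omega>' z))"
    using hom by (simp add: homogeneous_degree_zero_def)
  have norm_borel: "(\<lambda>z. norm (\<Omega>' z)) \<in> borel_measurable borel" by measurable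
  obtain c where "c > 0" and dist: "\<And>\<gamma> \<tau>. \<lbrakk>\<gamma> \<in> borel_measurable borel; \<And>y. \<gamma> y \<ge> 0;
        (\<integral>\<^sup>+y. ennreal (\<gamma> y powr q) \<partial>lborel) \<le> 1; \<tau> > 0\<rbrakk> \<Longrightarrow>
       emeasure lborel {x. ennreal \<tau> < (\<integral>\<^sup>+y. ennreal (norm (\<Omega>' (x - y)) * norm (x - y) powr (\<alpha> - ?n)) * ennreal (\<gamma> y) \<partial>lborel)}
       \<le> ennreal (1 / (c * \<tau> powr b))
          * (\<integral>\<^sup>+y. ennreal (\<gamma> y) * indicator {y. ennreal (c * \<tau> powr b) < ennreal (\<gamma> y)} y \<partial>lborel)"
    unfolding b_def
    apply (rule rough_kernel_distribution[OF norm_borel norm_ge_zero hom' \<alpha> \<beta> q])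
    subgoal premises prems for c
      by (rule prems(1)[OF prems(2)]) (use prems(3) in blast)
    done
  \<comment> \<open>The weak constant plus the strong one. For q = 1 the second summand is 0, as
    division by 0 yields 0, so D is still positive.\<close>
  define D where "D = c powr - q + q / (q - 1) * c powr - q"
  have "c powr - q > 0" using \<open>c > 0\<close> by simp
  have D_parts: "c powr - q \<le> D" "q / (q - 1) * c powr - q \<le> D"
    using \<open>q \<ge> 1\<close> \<open>c > 0\<close> by (simp_all add: D_def)
  show thesis
  proof (rule that[of D])
    show "D > 0" using D_parts(1) \<open>c powr - q > 0\<close> by linarith
    fix g :: "'a \<Rightarrow> complex"
    assume g: "g \<in> borel_measurable lebesgue" and g_norm: "(\<integral>\<^sup>+y. ennreal (norm (g y) powr q) \<partial>lebesgue) \<le> 1"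
    obtain g' where g'[measurable]: "g' \<in> borel_measurable lborel" and gg': "AE y in lborel. g y = g' y"
      using g by (rule completion_ex_borel_measurable_complex)
    have [measurable]: "g' \<in> borel_measurable borel" using g' by simp
    have g'_norm: "(\<integral>\<^sup>+y. ennreal (norm (g' y) powr q) \<partial>lborel) \<le> 1"
    proof -
      have "(\<integral>\<^sup>+y. ennreal (norm (g' y) powr q) \<partial>lborel) = (\<integral>\<^sup>+y. ennreal (norm (g y) powr q) \<partial>lborel)"
        using gg' by (intro nn_integral_cong_AE) auto
      then show ?thesis using g_norm by (simp add: nn_integral_completion)
    qed
    let ?T = "rough_fractional_integral \<Omega> \<alpha> g"
    define K where "K x y = rough_kernel \<Omega>' \<alpha> (x - y) * g' y" for x y
    have [measurable]: "(\<lambda>(x, y). K x y) \<in> borel_measurable (borel \<Otimes>\<^sub>M borel)"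
      unfolding K_def rough_kernel_def by measurable
    define U where "U x = (\<integral>\<^sup>+y. ennreal (norm (\<Omega>' (x - y)) * norm (x - y) powr (\<alpha> - ?n)) * ennreal (norm (g' y)) \<partial>lborel)" for x
    have [measurable]: "U \<in> borel_measurable borel"
      unfolding U_def by measurable
    have K_norm: "(\<integral>\<^sup>+y. ennreal (norm (K x y)) \<partial>lborel) = U x" for x
    proof -
      have "norm (K x y) = norm (\<Omega>' (x - y)) * norm (x - y) powr (\<alpha> - ?n) * norm (g' y)" for y
        using powr_minus[of "norm (x - y)" "?n - \<alpha>"]
        by (simp add: K_def rough_kernel_def norm_mult norm_divide norm_inverse divide_inverse)
      then show ?thesis by (simp add: U_def ennreal_mult')
    qed
    note version = rough_fractional_integral_version[OF \<open>\<Omega>' \<in> borel_measurable borel\<close> \<open>g' \<in> borel_measurable borel\<close> \<Omega> gg', of \<alpha>,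
        folded K_def]
    have exists_iff: "rough_fractional_integral_exists \<Omega> \<alpha> g x \<longleftrightarrow> U x < top" for x
    proof -
      have "K x \<in> borel_measurable lborel" by measurable
      then show ?thesis
        by (simp add: version integrable_iff_bounded K_norm)
    qed
    have T_le: "ennreal (norm (?T x)) \<le> U x" for x
    proof (cases "integrable lborel (K x)")
      case True
      then show ?thesis using integral_norm_bound_ennreal[OF True] by (simp add: version K_norm)
    qed (simp add: version not_integrable_integral_eq)
    \<comment> \<open>Where integrability fails the Bochner integral is 0, so the bound persists
      although \<open>enn2real\<close> maps \<open>top\<close> to 0.\<close>
    have T_le_real: "norm (?T x) \<le> enn2real (U x)" for x
    proof (cases "integrable lborel (K x)")
      case True
      then have "U x < top" using exists_iff version by simp
      then show ?thesis using T_le[of x] by (cases "U x") auto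
    qed (simp add: version not_integrable_integral_eq)
    have "?T \<in> borel_measurable borel"
    proof -
      have "(\<lambda>x. LINT y|lborel. K x y) \<in> borel_measurable borel"
        by measurable
      then show ?thesis by (simp add: version[abs_def])
    qed
    then have T_meas: "?T \<in> borel_measurable lborel" by simp
    have dist': "emeasure lborel {x. ennreal \<tau> < U x}
       \<le> ennreal (1 / (c * \<tau> powr b))
          * (\<integral>\<^sup>+y. ennreal (norm (g' y)) * indicator {y. ennreal (c * \<tau> powr b) < ennreal (norm (g' y))} y \<partial>lborel)"
      if "\<tau> > 0" for \<tau>
      unfolding U_def by (rule dist[OF _ _ g'_norm that]) auto
    have weak: "emeasure lborel {x. ennreal \<tau> < U x} \<le> ennreal (D * \<tau> powr - (?n / \<beta>))" if "\<tau> > 0" for \<tau>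
    proof -
      have "emeasure lborel {x. ennreal \<tau> < U x}
         \<le> ennreal ((c * \<tau> powr b) powr - q) * (\<integral>\<^sup>+y. ennreal (norm (g' y) powr q) \<partial>lborel)"
        using that \<open>c > 0\<close> \<open>q \<ge> 1\<close>
        by (intro order_trans[OF dist'[OF that]] nn_integral_above_level_le) auto
      also have "\<dots> \<le> ennreal ((c * \<tau> powr b) powr - q) * 1"
        by (intro mult_left_mono g'_norm) simp
      also have "(c * \<tau> powr b) powr - q = c powr - q * \<tau> powr - (?n / \<beta>)"
        using that \<open>c > 0\<close> by (simp add: powr_mult powr_powr bq[symmetric])
      also have "ennreal (c powr - q * \<tau> powr - (?n / \<beta>)) * 1 \<le> ennreal (D * \<tau> powr - (?n / \<beta>))"
        using D_parts(1) by (simp add: ennreal_leI mult_right_mono)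
      finally show ?thesis .
    qed
    \<comment> \<open>Such points lie in every level set of U, and the measures of the level sets
      tend to 0 as the level grows.\<close>
    have "emeasure lborel {x. U x = top} = 0"
    proof -
      have le: "emeasure lborel {x. U x = top} \<le> ennreal (D * \<tau> powr - (?n / \<beta>))" if "\<tau> > 0" for \<tau>
        by (rule order_trans[OF emeasure_mono weak[OF that]]) auto
      have "((\<lambda>\<tau>. ennreal (D * \<tau> powr - (?n / \<beta>))) \<longlongrightarrow> ennreal (D * 0)) at_top"
        using \<open>\<beta> > 0\<close> by (intro tendsto_ennrealI tendsto_mult_left tendsto_neg_powr filterlim_ident) auto
      moreover have "\<forall>\<^sub>F \<tau> in at_top. emeasure lborel {x. U x = top} \<le> ennreal (D * \<tau> powr - (?n / \<beta>))"
        using eventually_gt_at_top[of "0::real"] by eventually_elim (rule le)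
      ultimately have "emeasure lborel {x. U x = top} \<le> ennreal (D * 0)"
        by (intro tendsto_lowerbound) auto
      then show ?thesis by simp
    qed
    then have "AE x in lborel. U x < top"
      by (intro AE_I[of _ _ "{x. U x = top}"]) (auto simp: less_top[symmetric])
    then have "AE x in lebesgue. rough_fractional_integral_exists \<Omega> \<alpha> g x"
      unfolding exists_iff by (rule AE_completion)
    moreover have "?T \<in> borel_measurable lebesgue"
      by (rule measurable_completion[OF T_meas])
    moreover have "emeasure lebesgue {x. \<tau> < norm (?T x)} \<le> ennreal (D * \<tau> powr - (?n / \<beta>))" if "\<tau> > 0" for \<tau>
    proof -
      have "{x. \<tau> < norm (?T x)} \<in> sets lborel"
        using T_meas by measurable
      then have "emeasure lebesgue {x. \<tau> < norm (?T x)} = emeasure lborel {x. \<tau> < norm (?T x)}"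
        by simp
      also have "\<dots> \<le> emeasure lborel {x. ennreal \<tau> < U x}"
      proof (rule emeasure_mono)
        show "{x. \<tau> < norm (?T x)} \<subseteq> {x. ennreal \<tau> < U x}"
        proof clarify
          fix x assume "\<tau> < norm (?T x)"
          then have "ennreal \<tau> < ennreal (norm (?T x))" using that by (simp add: ennreal_less_iff)
          then show "ennreal \<tau> < U x" using T_le[of x] by (rule order_less_le_trans)
        qed
      qed measurable
      also have "\<dots> \<le> ennreal (D * \<tau> powr - (?n / \<beta>))" by (rule weak[OF that])
      finally show ?thesis .
    qed
    moreover have "(\<integral>\<^sup>+x. ennreal (norm (?T x) powr (?n / \<beta>)) \<partial>lebesgue) \<le> ennreal D" if "q > 1"
    proof -
      have "(\<integral>\<^sup>+x. ennreal (norm (?T x) powr (?n / \<beta>)) \<partial>lebesgue)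
          \<le> (\<integral>\<^sup>+x. ennreal (enn2real (U x) powr (b * q)) \<partial>lborel)"
        unfolding nn_integral_completion bq using T_le_real \<open>\<beta> > 0\<close>
        by (intro nn_integral_mono ennreal_leI powr_mono2) auto
      also have "\<dots> \<le> ennreal (q / (q - 1) * c powr - q) * (\<integral>\<^sup>+y. ennreal (norm (g' y) powr q) \<partial>lborel)"
        using \<open>b > 0\<close> \<open>c > 0\<close> that
        by (intro nn_integral_powr_of_distribution dist') auto
      also have "\<dots> \<le> ennreal D * 1"
        using D_parts(2) g'_norm by (intro mult_mono ennreal_leI) auto
      finally show ?thesis by simp
    qed
    ultimately show "(AE x in lebesgue. rough_fractional_integral_exists \<Omega> \<alpha> g x) \<and>
      ?T \<in> borel_measurable lebesgue \<and>
      (\<forall>\<tau>>0. emeasure lebesgue {x. \<tau> < norm (?T x)} \<le> ennreal (D * \<tau> powr - (?n / \<beta>))) \<and>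
      (q > 1 \<longrightarrow> (\<integral>\<^sup>+x. ennreal (norm (?T x) powr (?n / \<beta>)) \<partial>lebesgue) \<le> ennreal D)"
      by blast
  qed
qed

section \<open>Products with the rough fractional integral\<close>

lemma Lp_norm_real:
  assumes "p > 0"
  shows "Lp_norm M (ennreal p) h = ennreal_powr (\<integral>\<^sup>+x. ennreal (norm (h x) powr p) \<partial>M) (1 / p)"
  using assms by (simp add: Lp_norm_def)

text \<open>Dividing by a positive upper bound N of the norm, rather than by the norm itself, also
  covers functions that vanish almost everywhere.\<close>

lemma nn_integral_normalized_le_1:
  fixes h :: "'a \<Rightarrow> 'b::{second_countable_topology, real_normed_field}"
  assumes [measurable]: "h \<in> borel_measurable M" and "p > 0" "N > 0" and "Lp_norm M (ennreal p) h \<le> ennreal N"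
  shows "(\<integral>\<^sup>+x. ennreal (norm (h x / of_real N) powr p) \<partial>M) \<le> 1"
proof -
  let ?I = "\<integral>\<^sup>+x. ennreal (norm (h x) powr p) \<partial>M"
  have le: "ennreal_powr ?I (1 / p) \<le> ennreal N"
    using assms by (simp add: Lp_norm_real)
  then have "?I \<noteq> top" by (auto simp: ennreal_powr_def top_unique)
  then obtain i where i: "i \<ge> 0" "?I = ennreal i" by (cases ?I) auto
  with le have "i powr (1 / p) \<le> N" using \<open>N > 0\<close> by (simp add: ennreal_powr_def)
  then have "(i powr (1 / p)) powr p \<le> N powr p"
    using \<open>p > 0\<close> by (intro powr_mono2) auto
  then have "i \<le> N powr p" using i \<open>p > 0\<close> by (simp add: powr_powr)
  have "(\<integral>\<^sup>+x. ennreal (norm (h x / of_real N) powr p) \<partial>M)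
      = (\<integral>\<^sup>+x. ennreal (1 / N powr p) * ennreal (norm (h x) powr p) \<partial>M)"
    using \<open>N > 0\<close> by (intro nn_integral_cong) (simp add: norm_divide powr_divide ennreal_mult'[symmetric])
  also have "\<dots> = ennreal (1 / N powr p * i)"
    by (subst nn_integral_cmult) (auto simp: i ennreal_mult'[symmetric])
  also have "\<dots> \<le> ennreal 1"
    using \<open>i \<le> N powr p\<close> \<open>N > 0\<close> by (intro ennreal_leI) (simp add: field_simps)
  finally show ?thesis by simp
qed

text \<open>Rests on homogeneity of the power integral alone, without a triangle inequality, so
  exponents r < 1 are covered.\<close>

lemma Lp_norm_le_of_normalized:
  fixes h :: "'a \<Rightarrow> 'b::{second_countable_topology, real_normed_field}"
  assumes [measurable]: "h \<in> borel_measurable M" and "r > 0" "N > 0" "C \<ge> 0"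
    and I: "(\<integral>\<^sup>+x. ennreal (norm (h x / of_real N) powr r) \<partial>M) \<le> ennreal C"
  shows "Lp_norm M (ennreal r) h \<le> ennreal (C powr (1 / r) * N)"
proof -
  have "(\<integral>\<^sup>+x. ennreal (norm (h x) powr r) \<partial>M)
      = (\<integral>\<^sup>+x. ennreal (N powr r) * ennreal (norm (h x / of_real N) powr r) \<partial>M)"
    using \<open>N > 0\<close> by (intro nn_integral_cong) (simp add: norm_divide powr_divide ennreal_mult'[symmetric])
  also have "\<dots> = ennreal (N powr r) * (\<integral>\<^sup>+x. ennreal (norm (h x / of_real N) powr r) \<partial>M)"
    by (rule nn_integral_cmult) measurable
  also have "\<dots> \<le> ennreal (N powr r) * ennreal C"
    using I by (intro mult_left_mono) auto
  finally have le: "(\<integral>\<^sup>+x. ennreal (norm (h x) powr r) \<partial>M) \<le> ennreal (N powr r * C)"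
    by (simp add: ennreal_mult')
  then obtain i where i: "i \<ge> 0" "(\<integral>\<^sup>+x. ennreal (norm (h x) powr r) \<partial>M) = ennreal i"
    by (cases "\<integral>\<^sup>+x. ennreal (norm (h x) powr r) \<partial>M") (auto simp: top_unique)
  then have "i \<le> N powr r * C" using le \<open>C \<ge> 0\<close> by simp
  then have "i powr (1 / r) \<le> (N powr r * C) powr (1 / r)"
    using i \<open>r > 0\<close> by (intro powr_mono2) auto
  also have "\<dots> = C powr (1 / r) * N"
    using \<open>r > 0\<close> \<open>N > 0\<close> \<open>C \<ge> 0\<close> by (simp add: powr_mult powr_powr)
  finally show ?thesis
    using i \<open>r > 0\<close> by (simp add: Lp_norm_real ennreal_powr_def ennreal_leI)
qed

lemma weak_Lp_norm_le_of_normalized: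
  fixes h :: "'a \<Rightarrow> 'b::{second_countable_topology, real_normed_field}"
  assumes "r > 0" "N > 0" "C \<ge> 0"
    and dist: "\<And>t. t > 0 \<Longrightarrow> emeasure M {x \<in> space M. t < norm (h x / of_real N)} \<le> ennreal (C * t powr - r)"
  shows "weak_Lp_norm M r h \<le> ennreal (C powr (1 / r) * N)"
  unfolding weak_Lp_norm_def
proof (rule SUP_least)
  fix t :: real assume "t \<in> {0<..}"
  then have "t > 0" by simp
  have "{x \<in> space M. t < norm (h x)} = {x \<in> space M. t / N < norm (h x / of_real N)}"
    using \<open>N > 0\<close> by (auto simp: norm_divide divide_less_cancel)
  then have le: "emeasure M {x \<in> space M. t < norm (h x)} \<le> ennreal (C * (t / N) powr - r)"
    using dist[of "t / N"] \<open>t > 0\<close> \<open>N > 0\<close> by simp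
  then obtain i where i: "i \<ge> 0" "emeasure M {x \<in> space M. t < norm (h x)} = ennreal i"
    by (cases "emeasure M {x \<in> space M. t < norm (h x)}") (auto simp: top_unique)
  then have "i \<le> C * (t / N) powr - r" using le \<open>C \<ge> 0\<close> by simp
  then have "i powr (1 / r) \<le> (C * (t / N) powr - r) powr (1 / r)"
    using i \<open>r > 0\<close> by (intro powr_mono2) auto
  also have "\<dots> = C powr (1 / r) * (t / N) powr (- r * (1 / r))"
    using \<open>C \<ge> 0\<close> by (simp only: powr_mult powr_powr powr_ge_zero)
  also have "\<dots> = C powr (1 / r) * (N / t)"
    using \<open>r > 0\<close> \<open>N > 0\<close> \<open>t > 0\<close> by (simp add: powr_neg_one)
  finally have "t * i powr (1 / r) \<le> C powr (1 / r) * N"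
    using \<open>t > 0\<close> by (simp add: field_simps)
  then show "ennreal t * ennreal_powr (emeasure M {x \<in> space M. norm (h x) > t}) (1 / r) \<le> ennreal (C powr (1 / r) * N)"
    using i \<open>t > 0\<close> by (simp add: ennreal_powr_def ennreal_mult'[symmetric] ennreal_leI)
qed

text \<open>The norms A and B may be 0, whereas normalization needs positive bounds. The estimate is
  taken at A + e and B + e, and e tends to 0 from the right.\<close>

lemma product_bound_at_infimum:
  fixes A B :: ennreal and C :: real
  assumes "A < top" "B < top" "C \<ge> 0"
    and bound: "\<And>a b. \<lbrakk>a > 0; b > 0; A \<le> ennreal a; B \<le> ennreal b\<rbrakk> \<Longrightarrow> X \<le> ennreal (C * (a * b))"
  shows "X \<le> ennreal C * A * B"
proof -
  obtain a b where ab: "a \<ge> 0" "A = ennreal a" "b \<ge> 0" "B = ennreal b"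
    using assms by (metis enn2real_nonneg ennreal_enn2real)
  have "((\<lambda>e. ennreal (C * ((a + e) * (b + e)))) \<longlongrightarrow> ennreal (C * ((a + 0) * (b + 0)))) (at_right 0)"
    by (intro tendsto_intros)
  moreover have "\<forall>\<^sub>F e in at_right 0. X \<le> ennreal (C * ((a + e) * (b + e)))"
    using eventually_at_right_less[of "0::real"] by eventually_elim (rule bound; use ab in \<open>simp add: ennreal_leI\<close>)
  ultimately have "X \<le> ennreal (C * ((a + 0) * (b + 0)))"
    by (intro tendsto_lowerbound) auto
  then show ?thesis using ab \<open>C \<ge> 0\<close> by (simp add: ennreal_mult' mult.assoc)
qed

section \<open>Weak and strong Hoelder inequalities\<close>

text \<open>Since t = t^(r/p) t^(r/v), a product above t has a factor above its share. The shares
  are balanced so that both level sets have measure of order t^-r.\<close>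

lemma Hoelder_weak_type:
  fixes f h :: "'a \<Rightarrow> complex"
  assumes [measurable]: "f \<in> borel_measurable M" "h \<in> borel_measurable M"
    and pos: "p > 0" "v > 0" "r > 0" and exponents: "1 / r = 1 / p + 1 / v" and "D \<ge> 0"
    and f: "(\<integral>\<^sup>+x. ennreal (norm (f x) powr p) \<partial>M) \<le> 1"
    and h: "\<And>\<tau>. \<tau> > 0 \<Longrightarrow> emeasure M {x \<in> space M. \<tau> < norm (h x)} \<le> ennreal (D * \<tau> powr - v)"
    and "t > 0"
  shows "emeasure M {x \<in> space M. t < norm (f x * h x)} \<le> ennreal ((1 + D) * t powr - r)"
proof -
  have f_dist: "emeasure M {x \<in> space M. t powr (r / p) < norm (f x)} \<le> ennreal (t powr - r)"
  proof -
    have "{x \<in> space M. t powr (r / p) < norm (f x)}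
      \<subseteq> {x \<in> space M. 1 \<le> ennreal (t powr - r) * ennreal (norm (f x) powr p)}"
    proof clarsimp
      fix x assume "t powr (r / p) < norm (f x)"
      then have "(t powr (r / p)) powr p \<le> norm (f x) powr p"
        using pos by (intro powr_mono2) auto
      then have "t powr - r * t powr r \<le> t powr - r * norm (f x) powr p"
        using pos by (intro mult_left_mono) (auto simp: powr_powr)
      then have "ennreal 1 \<le> ennreal (t powr - r * norm (f x) powr p)"
        using \<open>t > 0\<close> by (intro ennreal_leI) (simp add: powr_minus)
      then show "1 \<le> ennreal (t powr - r) * ennreal (norm (f x) powr p)"
        by (simp add: ennreal_mult')
    qed
    then have "emeasure M {x \<in> space M. t powr (r / p) < norm (f x)}
      \<le> emeasure M {x \<in> space M. 1 \<le> ennreal (t powr - r) * ennreal (norm (f x) powr p)}"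
      by (rule emeasure_mono) measurable
    also have "\<dots> \<le> ennreal (t powr - r) * (\<integral>\<^sup>+x. ennreal (norm (f x) powr p) * indicator (space M) x \<partial>M)"
      by (rule nn_integral_Markov_inequality) auto
    also have "\<dots> \<le> ennreal (t powr - r) * 1"
      using f by (intro mult_left_mono) (simp_all cong: nn_integral_cong)
    finally show ?thesis by simp
  qed
  have "{x \<in> space M. t < norm (f x * h x)}
    \<subseteq> {x \<in> space M. t powr (r / p) < norm (f x)} \<union> {x \<in> space M. t powr (r / v) < norm (h x)}"
  proof clarsimp
    fix x assume t: "t < norm (f x * h x)" and not: "\<not> t powr (r / v) < cmod (h x)"
    show "t powr (r / p) < norm (f x)"
    proof (rule ccontr)
      assume "\<not> t powr (r / p) < norm (f x)"
      with not have "norm (f x) * norm (h x) \<le> t powr (r / p) * t powr (r / v)"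
        by (intro mult_mono) auto
      also have "\<dots> = t powr (r * (1 / p + 1 / v))"
        by (simp add: powr_add[symmetric] distrib_left)
      also have "\<dots> = t"
        using pos \<open>t > 0\<close> by (simp add: exponents[symmetric])
      finally show False using t by (simp add: norm_mult)
    qed
  qed
  then have "emeasure M {x \<in> space M. t < norm (f x * h x)}
    \<le> emeasure M ({x \<in> space M. t powr (r / p) < norm (f x)} \<union> {x \<in> space M. t powr (r / v) < norm (h x)})"
    by (rule emeasure_mono) measurable
  also have "\<dots> \<le> emeasure M {x \<in> space M. t powr (r / p) < norm (f x)}
      + emeasure M {x \<in> space M. t powr (r / v) < norm (h x)}"
    by (rule emeasure_subadditive) measurable
  also have "\<dots> \<le> ennreal (t powr - r) + ennreal (D * (t powr (r / v)) powr - v)"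
    using \<open>t > 0\<close> by (intro add_mono f_dist h) auto
  also have "\<dots> = ennreal ((1 + D) * t powr - r)"
    using pos \<open>D \<ge> 0\<close> by (simp add: powr_powr distrib_right)
  finally show ?thesis .
qed

text \<open>Young's inequality pointwise with the conjugate exponents p/r and v/r, which exceed 1
  even when r < 1. For normalized functions the resulting sum serves as well as a product.\<close>

lemma Hoelder_normalized:
  fixes f h :: "'a \<Rightarrow> complex"
  assumes [measurable]: "f \<in> borel_measurable M" "h \<in> borel_measurable M"
    and pos: "p > 0" "v > 0" "r > 0" and exponents: "1 / r = 1 / p + 1 / v" and "D \<ge> 0"
    and f: "(\<integral>\<^sup>+x. ennreal (norm (f x) powr p) \<partial>M) \<le> 1"
    and h: "(\<integral>\<^sup>+x. ennreal (norm (h x) powr v) \<partial>M) \<le> ennreal D"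
  shows "(\<integral>\<^sup>+x. ennreal (norm (f x * h x) powr r) \<partial>M) \<le> ennreal (1 + D)"
proof -
  have rp: "r / p < 1" "r / v < 1" "r / p + r / v = 1"
  proof -
    have "r * (1 / r) = r * (1 / p + 1 / v)" by (simp only: exponents)
    then show sum: "r / p + r / v = 1" using pos by (simp add: distrib_left)
    have "r / p > 0" "r / v > 0" using pos by auto
    then show "r / p < 1" "r / v < 1" using sum by linarith+
  qed
  have "norm (f x * h x) powr r \<le> norm (f x) powr p + norm (h x) powr v" for x
  proof -
    have "norm (f x * h x) powr r = norm (f x) powr r * norm (h x) powr r"
      by (simp add: norm_mult powr_mult)
    also have "\<dots> \<le> (norm (f x) powr r) powr (p / r) / (p / r) + (norm (h x) powr r) powr (v / r) / (v / r)"
      using rp pos by (intro Youngs_inequality) (auto simp: field_simps)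
    also have "\<dots> = r / p * norm (f x) powr p + r / v * norm (h x) powr v"
      using pos by (simp add: powr_powr mult.commute)
    also have "\<dots> \<le> 1 * norm (f x) powr p + 1 * norm (h x) powr v"
      using rp by (intro add_mono mult_right_mono) auto
    finally show ?thesis by simp
  qed
  then have "(\<integral>\<^sup>+x. ennreal (norm (f x * h x) powr r) \<partial>M)
    \<le> (\<integral>\<^sup>+x. ennreal (norm (f x) powr p + norm (h x) powr v) \<partial>M)"
    by (intro nn_integral_mono ennreal_leI)
  also have "\<dots> = (\<integral>\<^sup>+x. ennreal (norm (f x) powr p) \<partial>M) + (\<integral>\<^sup>+x. ennreal (norm (h x) powr v) \<partial>M)"
    by (simp add: nn_integral_add)
  also have "\<dots> \<le> 1 + ennreal D" using f h by (rule add_mono)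
  finally show ?thesis using \<open>D \<ge> 0\<close> by simp
qed

text \<open>True unconditionally: for nonzero c both integrands are integrable or neither is, with
  default value 0, and for c = 0 both sides are 0.\<close>

lemma rough_fractional_integral_divide:
  "rough_fractional_integral \<Omega> \<alpha> (\<lambda>y. g y / c) x = rough_fractional_integral \<Omega> \<alpha> g x / c"
  unfolding rough_fractional_integral_def by simp

lemma rough_fractional_integral_exists_divide:
  assumes "rough_fractional_integral_exists \<Omega> \<alpha> (\<lambda>y. g y / c) x" "c \<noteq> 0"
  shows "rough_fractional_integral_exists \<Omega> \<alpha> g x"
proof -
  have "integrable lebesgue (\<lambda>y. c * (rough_kernel \<Omega> \<alpha> (x - y) * (g y / c)))"
    using assms unfolding rough_fractional_integral_exists_def by (intro integrable_mult_right)
  then show ?thesis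
    using assms(2) by (simp add: rough_fractional_integral_exists_def)
qed

text \<open>By linearity f and g may be normalized; the bounds on T g in exponent v = n/\<beta> then
  combine with the Hoelder inequalities, because 1/v = 1/r - 1/p.\<close>

lemma rough_product_bounds:
  fixes \<Omega> :: "'a::euclidean_space \<Rightarrow> complex" and s :: ennreal and p q r \<alpha> :: real
  assumes \<Omega>: "\<Omega> \<in> Lp_space sphere_measure s" "homogeneous_degree_zero \<Omega>"
    and \<alpha>: "0 < \<alpha>" "\<alpha> < DIM('a)"
    and s: "s = top \<or> (q > 1 \<and> (\<exists>\<sigma>. s = ennreal \<sigma> \<and> q / (q - 1) \<le> \<sigma>))"
    and pqr: "p > 0" "q \<ge> 1" "r > 0" "r < p" and exponents: "1 / p + 1 / q = 1 / r + \<alpha> / DIM('a)"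
  obtains C where "C > 0"
    "\<And>f g. \<lbrakk>f \<in> Lp_space lebesgue (ennreal p); g \<in> Lp_space lebesgue (ennreal q)\<rbrakk> \<Longrightarrow>
      (AE x in lebesgue. rough_fractional_integral_exists \<Omega> \<alpha> g x) \<and>
      (\<lambda>x. f x * rough_fractional_integral \<Omega> \<alpha> g x) \<in> borel_measurable lebesgue \<and>
      weak_Lp_norm lebesgue r (\<lambda>x. f x * rough_fractional_integral \<Omega> \<alpha> g x)
        \<le> ennreal C * Lp_norm lebesgue (ennreal p) f * Lp_norm lebesgue (ennreal q) g \<and>
      (q > 1 \<longrightarrow> Lp_norm lebesgue (ennreal r) (\<lambda>x. f x * rough_fractional_integral \<Omega> \<alpha> g x)
        \<le> ennreal C * Lp_norm lebesgue (ennreal p) f * Lp_norm lebesgue (ennreal q) g)"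
proof -
  let ?n = "real DIM('a)"
  define \<beta> where "\<beta> = ?n / q - \<alpha>"
  define v where "v = ?n / \<beta>"
  \<comment> \<open>This identity makes \<beta> > 0, needed for the far part of the kernel,
    equivalent to r < p.\<close>
  have v_inverse: "\<beta> / ?n = 1 / r - 1 / p"
    using exponents by (simp add: \<beta>_def field_simps)
  moreover have "1 / r - 1 / p > 0"
    using pqr by (simp add: field_simps)
  ultimately have "\<beta> / ?n > 0" by simp
  then have "\<beta> > 0" by (simp add: zero_less_divide_iff)
  then have "v > 0" by (simp add: v_def)
  have rpv: "1 / r = 1 / p + 1 / v"
    using v_inverse by (simp add: v_def)
  obtain \<Omega>' where \<Omega>': "\<Omega>' \<in> borel_measurable borel" "homogeneous_degree_zero \<Omega>'"
    "AE z in lborel. \<Omega> z = \<Omega>' z"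
    "(q = 1 \<and> (\<exists>M. AE z in lborel. norm (\<Omega>' z) \<le> M)) \<or>
      (q > 1 \<and> (\<integral>\<^sup>+z. ennreal (norm (\<Omega>' z) powr (q / (q - 1))) * indicator (ball 0 1) z \<partial>lborel) < top)"
    using sphere_Lp_representative[OF \<Omega> \<open>q \<ge> 1\<close> s] by blast
  obtain D where "D > 0" and D: "\<And>g. \<lbrakk>g \<in> borel_measurable lebesgue;
      (\<integral>\<^sup>+y. ennreal (norm (g y) powr q) \<partial>lebesgue) \<le> 1\<rbrakk> \<Longrightarrow>
      (AE x in lebesgue. rough_fractional_integral_exists \<Omega> \<alpha> g x) \<and>
      rough_fractional_integral \<Omega> \<alpha> g \<in> borel_measurable lebesgue \<and>
      (\<forall>\<tau>>0. emeasure lebesgue {x. \<tau> < norm (rough_fractional_integral \<Omega> \<alpha> g x)}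
        \<le> ennreal (D * \<tau> powr - v)) \<and>
      (q > 1 \<longrightarrow> (\<integral>\<^sup>+x. ennreal (norm (rough_fractional_integral \<Omega> \<alpha> g x) powr v) \<partial>lebesgue) \<le> ennreal D)"
    using rough_fractional_integral_bounds[OF \<Omega>'(1-3) \<alpha> \<beta>_def \<open>\<beta> > 0\<close> \<Omega>'(4)] unfolding v_def by blast
  \<comment> \<open>Both Hoelder inequalities end with the constant 1 + D; the root undoes the r-th
    power.\<close>
  define C where "C = (1 + D) powr (1 / r)"
  show thesis
  proof (rule that[of C])
    show "C > 0" using \<open>D > 0\<close> by (simp add: C_def)
    fix f g :: "'a \<Rightarrow> complex"
    assume f: "f \<in> Lp_space lebesgue (ennreal p)" and g: "g \<in> Lp_space lebesgue (ennreal q)"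
    let ?T = "rough_fractional_integral \<Omega> \<alpha>"
    have [measurable]: "f \<in> borel_measurable lebesgue" "g \<in> borel_measurable lebesgue"
      using f g by (auto simp: Lp_space_def)
    have fin: "Lp_norm lebesgue (ennreal p) f < top" "Lp_norm lebesgue (ennreal q) g < top"
      using f g by (auto simp: Lp_space_def)
    have normalized: "(AE x in lebesgue. rough_fractional_integral_exists \<Omega> \<alpha> g x) \<and>
        ?T g \<in> borel_measurable lebesgue \<and>
        weak_Lp_norm lebesgue r (\<lambda>x. f x * ?T g x) \<le> ennreal (C * (a * b)) \<and>
        (q > 1 \<longrightarrow> Lp_norm lebesgue (ennreal r) (\<lambda>x. f x * ?T g x) \<le> ennreal (C * (a * b)))"
      if ab: "a > 0" "b > 0" "Lp_norm lebesgue (ennreal p) f \<le> ennreal a" "Lp_norm lebesgue (ennreal q) g \<le> ennreal b"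
      for a b
    proof -
      let ?f = "\<lambda>x. f x / of_real a" and ?g = "\<lambda>y. g y / of_real b"
      have F: "(\<integral>\<^sup>+x. ennreal (norm (?f x) powr p) \<partial>lebesgue) \<le> 1"
        using ab pqr by (intro nn_integral_normalized_le_1) auto
      have G: "(\<integral>\<^sup>+x. ennreal (norm (?g x) powr q) \<partial>lebesgue) \<le> 1"
        using ab pqr by (intro nn_integral_normalized_le_1) auto
      have [measurable]: "?f \<in> borel_measurable lebesgue" "?g \<in> borel_measurable lebesgue"
        by measurable
      note Dg = D[OF \<open>?g \<in> borel_measurable lebesgue\<close> G]
      have Tg: "?T ?g \<in> borel_measurable lebesgue" using Dg by blast
      have prod: "?f x * ?T ?g x = f x * ?T g x / of_real (a * b)" for x
        by (simp add: rough_fractional_integral_divide)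
      have "?T g = (\<lambda>x. of_real b * ?T ?g x)"
        using ab by (simp add: rough_fractional_integral_divide)
      then have T[measurable]: "?T g \<in> borel_measurable lebesgue"
        using Tg by simp
      have "AE x in lebesgue. rough_fractional_integral_exists \<Omega> \<alpha> g x"
      proof -
        have "AE x in lebesgue. rough_fractional_integral_exists \<Omega> \<alpha> ?g x" using Dg by blast
        then show ?thesis
          by (rule eventually_mono) (rule rough_fractional_integral_exists_divide, use ab in auto)
      qed
      moreover have "weak_Lp_norm lebesgue r (\<lambda>x. f x * ?T g x) \<le> ennreal ((1 + D) powr (1 / r) * (a * b))"
      proof (rule weak_Lp_norm_le_of_normalized)
        fix t :: real assume "t > 0"
        have "emeasure lebesgue {x \<in> space lebesgue. t < norm (?f x * ?T ?g x)} \<le> ennreal ((1 + D) * t powr - r)"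
          using Dg \<open>t > 0\<close> \<open>D > 0\<close> pqr \<open>v > 0\<close>
          by (intro Hoelder_weak_type[OF _ Tg _ _ _ rpv _ F]) auto
        then show "emeasure lebesgue {x \<in> space lebesgue. t < norm (f x * ?T g x / of_real (a * b))}
           \<le> ennreal ((1 + D) * t powr - r)"
          by (simp only: prod)
      qed (use ab pqr \<open>D > 0\<close> in auto)
      moreover have "Lp_norm lebesgue (ennreal r) (\<lambda>x. f x * ?T g x) \<le> ennreal ((1 + D) powr (1 / r) * (a * b))"
        if "q > 1"
      proof (rule Lp_norm_le_of_normalized)
        have "(\<integral>\<^sup>+x. ennreal (norm (?f x * ?T ?g x) powr r) \<partial>lebesgue) \<le> ennreal (1 + D)"
          using Dg \<open>q > 1\<close> \<open>D > 0\<close> pqr \<open>v > 0\<close>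
          by (intro Hoelder_normalized[OF _ Tg _ _ _ rpv _ F]) auto
        then show "(\<integral>\<^sup>+x. ennreal (norm (f x * ?T g x / of_real (a * b)) powr r) \<partial>lebesgue) \<le> ennreal (1 + D)"
          by (simp only: prod)
      qed (use ab pqr \<open>D > 0\<close> T in auto)
      ultimately show ?thesis using T by (simp add: C_def)
    qed
    \<comment> \<open>These two claims do not involve a and b, so any admissible pair will do;
      adding 1 to the norms makes it positive.\<close>
    have exists_meas: "(AE x in lebesgue. rough_fractional_integral_exists \<Omega> \<alpha> g x) \<and> ?T g \<in> borel_measurable lebesgue"
    proof -
      obtain a b where "a \<ge> 0" "Lp_norm lebesgue (ennreal p) f = ennreal a"
          "b \<ge> 0" "Lp_norm lebesgue (ennreal q) g = ennreal b"
        using fin by (metis enn2real_nonneg ennreal_enn2real)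
      then show ?thesis
        using normalized[of "a + 1" "b + 1"] by (simp add: ennreal_leI del: ennreal_plus)
    qed
    then have meas: "(\<lambda>x. f x * ?T g x) \<in> borel_measurable lebesgue"
      by (intro borel_measurable_times) auto
    have weak: "weak_Lp_norm lebesgue r (\<lambda>x. f x * ?T g x)
        \<le> ennreal C * Lp_norm lebesgue (ennreal p) f * Lp_norm lebesgue (ennreal q) g"
      using normalized \<open>C > 0\<close> fin by (intro product_bound_at_infimum) auto
    have strong: "Lp_norm lebesgue (ennreal r) (\<lambda>x. f x * ?T g x)
        \<le> ennreal C * Lp_norm lebesgue (ennreal p) f * Lp_norm lebesgue (ennreal q) g" if "q > 1"
      using normalized \<open>C > 0\<close> fin that by (intro product_bound_at_infimum) auto
    show "(AE x in lebesgue. rough_fractional_integral_exists \<Omega> \<alpha> g x) \<and>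
      (\<lambda>x. f x * ?T g x) \<in> borel_measurable lebesgue \<and>
      weak_Lp_norm lebesgue r (\<lambda>x. f x * ?T g x)
        \<le> ennreal C * Lp_norm lebesgue (ennreal p) f * Lp_norm lebesgue (ennreal q) g \<and>
      (q > 1 \<longrightarrow> Lp_norm lebesgue (ennreal r) (\<lambda>x. f x * ?T g x)
        \<le> ennreal C * Lp_norm lebesgue (ennreal p) f * Lp_norm lebesgue (ennreal q) g)"
      using exists_meas meas weak strong by (intro conjI impI) blast+
  qed
qed

section \<open>Conjugate exponents and the conclusion\<close>

text \<open>The identity is transferred from \<open>ennreal\<close> to the reals. A nonpositive s'
  would become 0 in \<open>ennreal\<close>, where 1/0 is \<open>top\<close>, contradicting the sum
  1.\<close>

lemma conjugate_exponent_ennreal: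
  fixes s :: ennreal and s' :: real
  assumes "1 < s" "1 / s + 1 / ennreal s' = 1"
  shows "s' \<ge> 1" and "s = top \<or> (\<exists>\<sigma>. s = ennreal \<sigma> \<and> \<sigma> > 1 \<and> 1 / \<sigma> + 1 / s' = 1)"
proof -
  have "s' > 0"
  proof (rule ccontr)
    assume "\<not> s' > 0"
    then have "1 / ennreal s' = top" by (simp add: ennreal_neg divide_ennreal_def)
    then show False using assms(2) by simp
  qed
  then have inv: "1 / ennreal s' = ennreal (1 / s')"
    using divide_ennreal[of 1 s'] by simp
  have sum: "s = top \<or> (\<exists>\<sigma>. s = ennreal \<sigma> \<and> \<sigma> > 1 \<and> 1 / \<sigma> + 1 / s' = 1)"
  proof (cases s)
    case (real \<sigma>)
    then have "\<sigma> > 1" using assms(1) ennreal_less_iff[of 1 \<sigma>] by simp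
    then have "1 / s = ennreal (1 / \<sigma>)" using real divide_ennreal[of 1 \<sigma>] by simp
    then have "ennreal (1 / \<sigma> + 1 / s') = ennreal 1"
      using assms(2) inv \<open>s' > 0\<close> \<open>\<sigma> > 1\<close> by simp
    then show ?thesis using real \<open>\<sigma> > 1\<close> \<open>s' > 0\<close> by (subst (asm) ennreal_inj) auto
  qed simp
  then show "s = top \<or> (\<exists>\<sigma>. s = ennreal \<sigma> \<and> \<sigma> > 1 \<and> 1 / \<sigma> + 1 / s' = 1)" .
  have "ennreal (1 / s') \<le> 1 / s + ennreal (1 / s')" by (intro add_increasing) auto
  also have "\<dots> = 1" using assms(2) by (simp add: inv)
  finally have "1 / s' \<le> 1" by (simp add: ennreal_le_1)
  then show "s' \<ge> 1" using \<open>s' > 0\<close> by (simp add: field_simps)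
qed

theorem theorem3p3:
  fixes \<Omega> :: "real ^ 'n \<Rightarrow> complex"
    and s :: ennreal and s' p q r \<alpha> :: real
  assumes "CARD('n) \<ge> 2"
    and "1 < s" and "1 / s + 1 / ennreal s' = 1"
    and "homogeneous_degree_zero \<Omega>"
    and "\<Omega> \<in> Lp_space sphere_measure s"
    and "0 < \<alpha>" and "\<alpha> < real CARD('n)"
    and "s' \<le> p" and "s' \<le> q"
    and "1 / p + 1 / q = 1 / r + \<alpha> / real CARD('n)"
    and "0 < r" and "r < min p q"
  shows
    "(s' < p \<and> s' < q \<longrightarrow>
       (\<exists>C::real. C > 0 \<and>
         (\<forall>f :: real ^ 'n \<Rightarrow> complex. \<forall>g :: real ^ 'n \<Rightarrow> complex.
           f \<in> Lp_space lebesgue (ennreal p) \<longrightarrow> g \<in> Lp_space lebesgue (ennreal q) \<longrightarrow>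
             (AE x in lebesgue. rough_fractional_integral_exists \<Omega> \<alpha> g x) \<and>
             (\<lambda>x. f x * rough_fractional_integral \<Omega> \<alpha> g x) \<in> borel_measurable lebesgue \<and>
             Lp_norm lebesgue (ennreal r) (\<lambda>x. f x * rough_fractional_integral \<Omega> \<alpha> g x)
               \<le> ennreal C * Lp_norm lebesgue (ennreal p) f * Lp_norm lebesgue (ennreal q) g)))
     \<and>
     ((s' = p \<and> s' < q) \<or> (s' = q \<and> s' < p) \<longrightarrow>
       (\<exists>C::real. C > 0 \<and>
         (\<forall>f :: real ^ 'n \<Rightarrow> complex. \<forall>g :: real ^ 'n \<Rightarrow> complex.
           f \<in> Lp_space lebesgue (ennreal p) \<longrightarrow> g \<in> Lp_space lebesgue (ennreal q) \<longrightarrow>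
             (AE x in lebesgue. rough_fractional_integral_exists \<Omega> \<alpha> g x) \<and>
             (\<lambda>x. f x * rough_fractional_integral \<Omega> \<alpha> g x) \<in> borel_measurable lebesgue \<and>
             weak_Lp_norm lebesgue r (\<lambda>x. f x * rough_fractional_integral \<Omega> \<alpha> g x)
               \<le> ennreal C * Lp_norm lebesgue (ennreal p) f * Lp_norm lebesgue (ennreal q) g)))"
proof -
  have s': "s' \<ge> 1" and conj: "s = top \<or> (\<exists>\<sigma>. s = ennreal \<sigma> \<and> \<sigma> > 1 \<and> 1 / \<sigma> + 1 / s' = 1)"
    using conjugate_exponent_ennreal[OF assms(2,3)] by auto
  have "q \<ge> 1" "p > 0" "r < p" using s' assms(8,9,12) by auto
  \<comment> \<open>The condition q \<ge> s' means that the exponent conjugate to q is at most s.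
    For finite s the reciprocal 1/\<sigma> is positive, which forces q > 1.\<close>
  have s: "s = top \<or> (q > 1 \<and> (\<exists>\<sigma>. s = ennreal \<sigma> \<and> q / (q - 1) \<le> \<sigma>))"
    using conj
  proof (elim disjE exE conjE)
    fix \<sigma> assume \<sigma>: "s = ennreal \<sigma>" "\<sigma> > 1" "1 / \<sigma> + 1 / s' = 1"
    have "1 / q \<le> 1 / s'" using s' \<open>s' \<le> q\<close> by (intro divide_left_mono) auto
    then have le: "1 / \<sigma> + 1 / q \<le> 1" using \<sigma>(3) by linarith
    moreover have "1 / \<sigma> > 0" using \<sigma>(2) by simp
    ultimately have "1 / q < 1" by linarith
    then have "q > 1" using \<open>q \<ge> 1\<close> by (simp add: field_simps)
    then have "q / (q - 1) \<le> \<sigma>" using le \<sigma>(2) by (simp add: field_simps)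
    then show ?thesis using \<sigma>(1) \<open>q > 1\<close> by blast
  qed simp
  obtain C where C: "C > 0"
    "\<And>f g. \<lbrakk>f \<in> Lp_space lebesgue (ennreal p); g \<in> Lp_space lebesgue (ennreal q)\<rbrakk> \<Longrightarrow>
      (AE x in lebesgue. rough_fractional_integral_exists \<Omega> \<alpha> g x) \<and>
      (\<lambda>x. f x * rough_fractional_integral \<Omega> \<alpha> g x) \<in> borel_measurable lebesgue \<and>
      weak_Lp_norm lebesgue r (\<lambda>x. f x * rough_fractional_integral \<Omega> \<alpha> g x)
        \<le> ennreal C * Lp_norm lebesgue (ennreal p) f * Lp_norm lebesgue (ennreal q) g \<and>
      (q > 1 \<longrightarrow> Lp_norm lebesgue (ennreal r) (\<lambda>x. f x * rough_fractional_integral \<Omega> \<alpha> g x)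
        \<le> ennreal C * Lp_norm lebesgue (ennreal p) f * Lp_norm lebesgue (ennreal q) g)"
    using rough_product_bounds[OF assms(5,4) _ _ s \<open>p > 0\<close> \<open>q \<ge> 1\<close> \<open>0 < r\<close> \<open>r < p\<close>, of \<alpha>] assms(6,7,10)
    by auto
  \<comment> \<open>In part (i), q > s' and s' \<ge> 1 give q > 1 and so the strong bound; the weak
    bound holds for every admissible q, which settles both cases of part (ii).\<close>
  show ?thesis
    using C s' by (intro conjI impI exI[of _ C] allI) auto
qed

end
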